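(* Let $(G,\chi)$ be an augmented group with $0$th characteristic polynomial $\Delta$ such that $\mathcal{M}\cong\mathcal{R}_1/(\Delta)$. For any positive integer $r$, let $\Phi$ be the product of the distinct cyclotomic polynomials $\Phi_d$ such that $d\mid r$ and $\Phi_d\mid\Delta$ (with $\Phi=1$ if there are none). Then the $r$th torsion number of $(G,\chi)$ is $$b_r=\Bigl|\prod_{\zeta^r=1,\ \Delta(\zeta)\neq 0}\Bigl(\frac{\Delta}{\Phi}\Bigr)(\zeta)\Bigr|,$$ where the product is over all complex $r$th roots of unity $\zeta$ with $\Delta(\zeta)\ne 0$.
   Context: An augmented group is a pair $(G,\chi)$ where $G$ is a finitely generated group and $\chi:G\to\mathbb{Z}$ is an epimorphism. Let $\mathcal{R}_1=\mathbb{Z}[t,t^{-1}]$. The abelianization $\mathcal{M}$ of $\ker\chi$ is a finitely generated $\mathcal{R}_1$-module, with $t$ acting by conjugation by an element $x\in G$ with $\chi(x)=1$. Write $\mathcal{M}\cong \mathcal{R}_1^N/\mathcal{A}\mathcal{R}_1^M$ with $\mathcal{A}$ an $N\times M$ matrix over $\mathcal{R}_1$, $M\ge N$. The $0$th characteristic polynomial $\Delta$ is a greatest common divisor in $\mathcal{R}_1$ of the $N\times N$ minors of $\mathcal{A}$, well defined up to units of $\mathcal{R}_1$. For a positive integer $r$ put $\mathcal{M}_r=\mathcal{M}/(t^r-1)\mathcal{M}$, a finitely generated abelian group; the $r$th torsion number $b_r$ is the order of the torsion subgroup of $\mathcal{M}_r$. $\Phi_d$ denotes the $d$th cyclotomic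 polynomial. An empty product equals $1$. *)

theory Defs
  imports
    Complex_Main
    "HOL-Library.Poly_Mapping"
    "HOL-Computational_Algebra.Polynomial"
    "HOL-Algebra.Elementary_Groups"
    "HOL-Algebra.Generated_Groups"
    "HOL-Algebra.Ideal"
    "Jordan_Normal_Form.VS_Connect"
    "Jordan_Normal_Form.Char_Poly"
    "Jordan_Normal_Form.DL_Submatrix"
begin

section \<open>Integer Laurent polynomials\<close>

text \<open>The ring \<open>\<int>[t, t\<inverse>]\<close> as the group ring of the additive group of integers: the
  coefficient of \<open>t\<close> to the power \<open>k\<close> in \<open>p\<close> is \<open>Poly_Mapping.lookup p k\<close>, and
  multiplication of \<^type>\<open>poly_mapping\<close> is convolution.\<close>

type_synonym laurent = "int \<Rightarrow>\<^sub>0 int"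

definition laurent_t :: laurent where
  "laurent_t = Poly_Mapping.single 1 1"

definition laurent_of_poly :: "int poly \<Rightarrow> laurent" where
  "laurent_of_poly p = (\<Sum>i\<le>degree p. Poly_Mapping.single (int i) (coeff p i))"

definition laurent_eval :: "laurent \<Rightarrow> complex \<Rightarrow> complex" where
  "laurent_eval p z = (\<Sum>k\<in>Poly_Mapping.keys p. of_int (Poly_Mapping.lookup p k) * z powi k)"

text \<open>The quotient \<open>a / b\<close> in the integral domain of Laurent polynomials; meaningful if
  \<open>b\<close> is nonzero and divides \<open>a\<close>.\<close>

definition laurent_quotient :: "laurent \<Rightarrow> laurent \<Rightarrow> laurent" where
  "laurent_quotient a b = (THE q. a = q * b)"

lemma laurent_quotient_mult:
  assumes "b \<noteq> 0" "b dvd a"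
  shows "laurent_quotient a b * b = a"
proof -
  from assms(2) obtain q where q: "a = q * b"
    by (metis dvdE mult.commute)
  then have "laurent_quotient a b = q"
    unfolding laurent_quotient_def using assms(1) by (intro the_equality) auto
  with q show ?thesis by simp
qed


section \<open>Cyclotomic polynomials\<close>

definition primitive_roots :: "nat \<Rightarrow> complex set" where
  "primitive_roots d = {\<zeta>. \<zeta> ^ d = 1 \<and> (\<forall>k. 0 < k \<and> k < d \<longrightarrow> \<zeta> ^ k \<noteq> 1)}"

definition cyclotomic :: "nat \<Rightarrow> int poly" where
  "cyclotomic d =
    (THE p. map_poly (of_int :: int \<Rightarrow> complex) p = (\<Prod>\<zeta>\<in>primitive_roots d. [:-\<zeta>, 1:]))"

text \<open>The product over the primitive roots does have integer coefficients.\<close>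

lemma finite_primitive_roots: "d > 0 \<Longrightarrow> finite (primitive_roots d)"
  unfolding primitive_roots_def
  by (rule finite_subset[OF _ finite_roots_unity[of d]]) auto

lemma primitive_root_power_eq_1_iff:
  assumes "\<zeta> \<in> primitive_roots d" "d > 0"
  shows "\<zeta> ^ n = 1 \<longleftrightarrow> d dvd n"
proof
  assume *: "\<zeta> ^ n = 1"
  have "\<zeta> ^ n = (\<zeta> ^ d) ^ (n div d) * \<zeta> ^ (n mod d)"
    by (simp flip: power_mult power_add)
  with * assms have "\<zeta> ^ (n mod d) = 1"
    by (simp add: primitive_roots_def)
  moreover have "n mod d < d" using assms by simp
  ultimately have "n mod d = 0"
    using assms unfolding primitive_roots_def by (metis (mono_tags, lifting) mem_Collect_eq neq0_conv)
  then show "d dvd n" by auto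
next
  assume "d dvd n"
  then show "\<zeta> ^ n = 1"
    using assms by (auto simp: primitive_roots_def power_mult)
qed

lemma roots_unity_eq_UN_primitive_roots:
  assumes "n > 0"
  shows "{\<zeta>::complex. \<zeta> ^ n = 1} = (\<Union>d\<in>{d. d dvd n}. primitive_roots d)"
proof (intro equalityI subsetI)
  fix \<zeta> :: complex assume "\<zeta> \<in> {\<zeta>. \<zeta> ^ n = 1}"
  then have n: "\<zeta> ^ n = 1" by simp
  define d where "d = (LEAST k. 0 < k \<and> \<zeta> ^ k = 1)"
  have d: "0 < d \<and> \<zeta> ^ d = 1"
    unfolding d_def by (rule LeastI[of _ n]) (use n assms in auto)
  have "\<zeta> \<in> primitive_roots d"
    unfolding primitive_roots_def using d not_less_Least[of _ "\<lambda>k. 0 < k \<and> \<zeta> ^ k = 1"]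
    by (auto simp: d_def)
  with d n show "\<zeta> \<in> (\<Union>d\<in>{d. d dvd n}. primitive_roots d)"
    using primitive_root_power_eq_1_iff by blast
next
  fix \<zeta> :: complex assume "\<zeta> \<in> (\<Union>d\<in>{d. d dvd n}. primitive_roots d)"
  then show "\<zeta> \<in> {\<zeta>. \<zeta> ^ n = 1}"
    using primitive_root_power_eq_1_iff assms by (auto intro: Nat.gr0I)
qed

lemma prod_primitive_roots:
  assumes "n > 0"
  shows "(\<Prod>d | d dvd n. \<Prod>\<zeta>\<in>primitive_roots d. [:-\<zeta>, 1:]) = monom 1 n - 1"
proof -
  have pos: "d > 0" if "d dvd n" for d
    using that assms by (auto intro: Nat.gr0I)
  have disj: "primitive_roots d \<inter> primitive_roots e = {}" if "d dvd n" "e dvd n" "d \<noteq> e" for d e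
    using primitive_root_power_eq_1_iff pos that by (metis disjoint_iff dvd_antisym dvd_refl)
  let ?U = "{\<zeta>::complex. \<zeta> ^ n = 1}"
  let ?P = "\<Prod>\<zeta>\<in>?U. [:-\<zeta>, 1:]"
  have fin: "finite ?U" using assms by (intro finite_roots_unity) simp
  have deg: "degree ?P = n"
    by (subst degree_prod_eq_sum_degree) (use card_roots_unity_eq[OF assms] in auto)
  have "(\<Prod>d | d dvd n. \<Prod>\<zeta>\<in>primitive_roots d. [:-\<zeta>, 1:]) = ?P"
    unfolding roots_unity_eq_UN_primitive_roots[OF assms]
    by (rule prod.UNION_disjoint[symmetric])
       (use assms pos disj finite_primitive_roots in auto)
  also have "?P = monom 1 n - 1"
  proof (rule poly_eqI_degree_lead_coeff[where n = n and A = ?U])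
    have "lead_coeff ?P = 1" by (simp add: lead_coeff_prod)
    then show "coeff ?P n = coeff (monom 1 n - 1) n"
      using deg assms by simp
    show "degree (monom 1 n - 1 :: complex poly) \<le> n"
      by (rule degree_diff_le) (auto simp: degree_monom_le)
    show "poly ?P z = poly (monom 1 n - 1) z" if "z \<in> ?U" for z
      using that fin by (auto simp: poly_prod poly_monom prod_zero_iff)
  qed (use card_roots_unity_eq[OF assms] deg in auto)
  finally show ?thesis .
qed

lemma map_poly_of_int_cyclotomic:
  assumes "d > 0"
  shows "map_poly of_int (cyclotomic d) = (\<Prod>\<zeta>\<in>primitive_roots d. [:-\<zeta>, 1:])"
proof -
  let ?C = "\<lambda>d. \<Prod>\<zeta>\<in>primitive_roots d. [:-\<zeta>, 1:]"
  let ?h = "map_poly (of_int :: int \<Rightarrow> complex)"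
  have "\<exists>p. ?h p = ?C d" using assms
  proof (induction d rule: less_induct)
    case (less n)
    let ?D = "{d. d dvd n \<and> d \<noteq> n}"
    have "\<exists>p. ?h p = ?C d" if "d \<in> ?D" for d
      using that less by (intro less.IH) (auto intro: Nat.gr0I dest: dvd_imp_le)
    then obtain c where c: "\<And>d. d \<in> ?D \<Longrightarrow> ?h (c d) = ?C d" by metis
    define g where "g = (\<Prod>d\<in>?D. c d)"
    have hg: "?h g = (\<Prod>d\<in>?D. ?C d)"
      unfolding g_def of_int_poly_hom.hom_prod using c by simp
    have "lead_coeff (?h g) = 1"
      unfolding hg by (simp add: lead_coeff_prod)
    then have lc: "lead_coeff g = 1" by simp
    then have g0: "g \<noteq> 0" by auto
    obtain q s where qs: "pseudo_divmod (monom 1 n - 1) g = (q, s)" by force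
    from pseudo_divmod[OF g0 qs] lc
    have eq: "monom 1 n - 1 = g * q + s" and s: "s = 0 \<or> degree s < degree g" by auto
    have "finite {d. d dvd n}" using less.prems by simp
    moreover have "{d. d dvd n} = insert n ?D" by auto
    ultimately have "monom 1 n - 1 = ?C n * ?h g"
      unfolding hg prod_primitive_roots[OF less.prems, symmetric]
      by (simp add: prod.insert_remove Diff_insert_absorb)
    moreover have "monom 1 n - 1 = ?h g * ?h q + ?h s"
      using arg_cong[OF eq, of ?h] by (simp add: hom_distribs map_poly_monom)
    ultimately have *: "?h s = (?C n - ?h q) * ?h g" by (simp add: algebra_simps)
    have "?C n - ?h q = 0"
    proof (rule ccontr)
      assume "?C n - ?h q \<noteq> 0"
      moreover from g0 have "?h g \<noteq> 0" by simp
      ultimately have "degree (?h s) \<ge> degree (?h g)" "?h s \<noteq> 0"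
        unfolding * by (auto simp: degree_mult_eq)
      with s show False by simp
    qed
    then show ?case by (intro exI[of _ q]) simp
  qed
  then obtain p where p: "?h p = ?C d" by blast
  then have "cyclotomic d = p"
    unfolding cyclotomic_def by (intro the_equality) (auto simp flip: p)
  with p show ?thesis by simp
qed


section \<open>Modules\<close>

definition module_iso ::
  "('a, 'r) ring_scheme \<Rightarrow> ('a, 'b, 'm) module_scheme \<Rightarrow> ('a, 'c, 'n) module_scheme \<Rightarrow> bool" where
  "module_iso R M N \<longleftrightarrow>
    (\<exists>f \<in> LinearCombinations.module_hom R M N. bij_betw f (carrier M) (carrier N))"

text \<open>The ring-multiplication fields of a module record are unused.\<close>

definition quotient_module ::
  "('a, 'b, 'm) module_scheme \<Rightarrow> 'b set \<Rightarrow> ('a, 'b set) module" where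
  "quotient_module M W =
    \<lparr>carrier = a_rcosets\<^bsub>M\<^esub> W, monoid.mult = undefined, one = undefined,
     zero = W, add = set_add M, module.smult = (\<lambda>a C. \<Union>c\<in>C. W +>\<^bsub>M\<^esub> (a \<odot>\<^bsub>M\<^esub> c))\<rparr>"

definition regular_module :: "('a :: comm_ring_1, 'a) module" where
  "regular_module =
    \<lparr>carrier = UNIV, monoid.mult = (*), one = 1, zero = 0, add = (+), module.smult = (*)\<rparr>"

definition torsion_elements :: "('a, 'b, 'm) module_scheme \<Rightarrow> 'b set" where
  "torsion_elements M = {m \<in> carrier M. \<exists>n::nat. n > 0 \<and> [n] \<cdot>\<^bsub>M\<^esub> m = \<zero>\<^bsub>M\<^esub>}"


section \<open>Augmented groups\<close>

definition augmented_group :: "('g, 'x) monoid_scheme \<Rightarrow> ('g \<Rightarrow> int) \<Rightarrow> bool" where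
  "augmented_group G \<chi> \<longleftrightarrow>
    group G \<and> (\<exists>S. finite S \<and> S \<subseteq> carrier G \<and> generate G S = carrier G) \<and>
    \<chi> \<in> epi G integer_group"

definition kernel_abelianization :: "('g, 'x) monoid_scheme \<Rightarrow> ('g \<Rightarrow> int) \<Rightarrow> 'g set monoid" where
  "kernel_abelianization G \<chi> =
    (let K = G\<lparr>carrier := kernel G integer_group \<chi>\<rparr> in K Mod derived K (carrier K))"

definition conjugate :: "('g, 'x) monoid_scheme \<Rightarrow> 'g \<Rightarrow> 'g \<Rightarrow> 'g" where
  "conjugate G y g = y \<otimes>\<^bsub>G\<^esub> g \<otimes>\<^bsub>G\<^esub> inv\<^bsub>G\<^esub> y"

text \<open>The abelianization of the kernel of \<open>\<chi>\<close>, written additively, as a module over the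
  Laurent polynomials. The variable acts on a coset of the commutator subgroup by elementwise
  conjugation \<open>g \<mapsto> x g x\<inverse>\<close>; hence a Laurent polynomial with coefficients \<open>p\<^sub>k\<close> sends \<open>C\<close>
  to the product over \<open>k\<close> of the \<open>p\<^sub>k\<close>-th powers of the conjugates of \<open>C\<close> by the \<open>k\<close>-th
  power of \<open>x\<close>.\<close>

definition augmentation_module ::
  "('g, 'x) monoid_scheme \<Rightarrow> ('g \<Rightarrow> int) \<Rightarrow> 'g \<Rightarrow> (laurent, 'g set) module" where
  "augmentation_module G \<chi> x =
    (let A = kernel_abelianization G \<chi> in
     \<lparr>carrier = carrier A, monoid.mult = undefined, one = undefined,
      zero = \<one>\<^bsub>A\<^esub>, add = (\<otimes>\<^bsub>A\<^esub>),
      module.smult = (\<lambda>p C. \<Otimes>\<^bsub>A\<^esub>k\<in>Poly_Mapping.keys p.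
        (conjugate G (x [^]\<^bsub>G\<^esub> (k::int)) ` C) [^]\<^bsub>A\<^esub> Poly_Mapping.lookup p k)\<rparr>)"

definition is_gcd_of :: "'a :: comm_ring_1 set \<Rightarrow> 'a \<Rightarrow> bool" where
  "is_gcd_of S g \<longleftrightarrow> (\<forall>s\<in>S. g dvd s) \<and> (\<forall>c. (\<forall>s\<in>S. c dvd s) \<longrightarrow> c dvd g)"

text \<open>\<open>D\<close> is a 0th characteristic polynomial of the module \<open>M\<close>; it is determined only up to
  units, so this is a predicate.\<close>

definition char_poly_0 :: "(laurent, 'b, 'm) module_scheme \<Rightarrow> laurent \<Rightarrow> bool" where
  "char_poly_0 M D \<longleftrightarrow>
    (\<exists>n m A. A \<in> carrier_mat n m \<and> n \<le> m \<and>
      module_iso (class_ring :: laurent ring) M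
        (quotient_module (module_vec TYPE(laurent) n) {A *\<^sub>v v | v. v \<in> carrier_vec m}) \<and>
      is_gcd_of {det (submatrix A {..<n} J) | J. J \<subseteq> {..<m} \<and> card J = n} D)"

definition reduced_module :: "(laurent, 'b, 'm) module_scheme \<Rightarrow> nat \<Rightarrow> (laurent, 'b set) module"
  where "reduced_module M r =
    quotient_module M {(laurent_t ^ r - 1) \<odot>\<^bsub>M\<^esub> m | m. m \<in> carrier M}"

definition torsion_number :: "(laurent, 'b, 'm) module_scheme \<Rightarrow> nat \<Rightarrow> nat" where
  "torsion_number M r = card (torsion_elements (reduced_module M r))"

definition cyclotomic_part :: "laurent \<Rightarrow> nat \<Rightarrow> laurent" where
  "cyclotomic_part D r =
    (\<Prod>d | d dvd r \<and> laurent_of_poly (cyclotomic d) dvd D. laurent_of_poly (cyclotomic d))"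

end

theory Submission
  imports Defs "HOL-Number_Theory.Cong"
begin

text \<open>
  Write \<open>\<Delta>\<close> as a power of \<open>t\<close> times an integer polynomial \<open>D\<close>. Modulo \<open>t ^ r - 1\<close> the variable is
  already invertible among polynomials, so \<open>M / (t ^ r - 1) M\<close> is the abelian group
  \<open>\<int>[t] / (D, t ^ r - 1)\<close>. Let \<open>\<Phi>\<close> be the product of the cyclotomic polynomials that divide both
  generators, and put \<open>D = \<Phi> g\<close> and \<open>t ^ r - 1 = \<Phi> \<Psi>\<close>. Since \<open>\<Phi>\<close> is monic, \<open>\<int>[t] / (\<Phi>)\<close> is torsion
  free; and since \<open>g\<close> and \<open>\<Psi>\<close> have no common root, the ideal \<open>(g, \<Psi>)\<close> contains a positive integer.
  Hence the torsion subgroup is \<open>(\<Phi>) / (\<Phi> g, \<Phi> \<Psi>)\<close>, a copy of \<open>\<int>[t] / (g, \<Psi>)\<close>, and the formula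
  says that the order of this group is the modulus of the product of the values of \<open>g\<close> at the roots
  of \<open>\<Psi>\<close>, that is, of the resultant (\<open>card_cosets_ideal2\<close>).

  The order of \<open>\<int>[t] / (g, \<Psi>)\<close> is computed by comparing two bases of the lattice of elements of the
  ideal that have degree less than \<open>s = degree \<Psi>\<close>, modulo \<open>\<Psi>\<close>. One is triangular, with an element
  of each degree \<open>i < s\<close> whose leading coefficient is as small as possible; counting remainders, the
  index is the product of these leading coefficients. The other consists of the \<open>t ^ i g\<close>. Evaluating
  both at the roots of \<open>\<Psi>\<close> gives complex matrices with determinants \<open>index \<cdot> det V\<close> and
  \<open>det V \<cdot> (\<Prod>\<zeta>. g \<zeta>)\<close>, where \<open>V\<close> is a Vandermonde matrix, and the two differ by a unimodular factor.

  That the roots of \<open>\<Psi>\<close> are exactly the \<open>r\<close>-th roots of unity with \<open>\<Delta> \<zeta> \<noteq> 0\<close> depends on the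
  irreducibility of the cyclotomic polynomials (\<open>cyclotomic_dvd_iff\<close>): if \<open>\<Delta>\<close> vanishes at one
  primitive \<open>d\<close>-th root of unity, then the whole \<open>d\<close>-th cyclotomic polynomial divides it. The proof
  given here compares \<open>f(t ^ p)\<close> with \<open>f(t) ^ p\<close> for large primes \<open>p\<close>.
\<close>

section \<open>Integer polynomials with simple complex roots\<close>

definition ceval :: "int poly \<Rightarrow> complex \<Rightarrow> complex" where
  "ceval p z = poly (map_poly of_int p) z"

lemma ceval_simps [simp]:
  "ceval 0 z = 0" "ceval 1 z = 1"
  "ceval (p + q) z = ceval p z + ceval q z"
  "ceval (p - q) z = ceval p z - ceval q z"
  "ceval (p * q) z = ceval p z * ceval q z"
  "ceval (p ^ n) z = ceval p z ^ n"
  "ceval (smult a p) z = of_int a * ceval p z"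
  "ceval (monom a n) z = of_int a * z ^ n"
  "ceval [:a:] z = of_int a"
  "ceval (of_nat n) z = of_nat n"
  by (simp_all add: ceval_def hom_distribs map_poly_monom poly_monom of_int_poly_hom.hom_add
      of_int_poly_hom.hom_minus of_int_poly_hom.hom_mult of_int_poly_hom.hom_power)

lemma ceval_sum: "ceval (sum f A) z = (\<Sum>a\<in>A. ceval (f a) z)"
  by (induction A rule: infinite_finite_induct) auto

lemma ceval_pcompose: "ceval (pcompose p q) z = ceval p (ceval q z)"
  unfolding ceval_def by (simp add: of_int_hom.map_poly_pcompose poly_pcompose)

lemma ceval_eq_sum:
  assumes "\<And>i. i \<ge> n \<Longrightarrow> coeff p i = 0"
  shows "ceval p z = (\<Sum>i<n. of_int (coeff p i) * z ^ i)"
proof -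
  have "p = (\<Sum>i<n. monom (coeff p i) i)"
    using assms by (intro poly_eqI) (auto simp: coeff_sum not_less)
  then have "ceval p z = ceval (\<Sum>i<n. monom (coeff p i) i) z" by simp
  then show ?thesis by (simp add: ceval_sum)
qed

lemma monic_division:
  fixes P f :: "int poly"
  assumes "lead_coeff P = 1"
  obtains q r where "f = P * q + r" "\<And>i. i \<ge> degree P \<Longrightarrow> coeff r i = 0"
proof -
  have P0: "P \<noteq> 0" using assms by auto
  obtain q r where qr: "pseudo_divmod f P = (q, r)" by force
  from pseudo_divmod[OF P0 qr] assms
  have "f = P * q + r" "r = 0 \<or> degree r < degree P" by auto
  then show ?thesis by (intro that[of q r]) (auto intro: coeff_eq_0)
qed

text \<open>Splitting over the complex numbers into distinct linear factors is recorded together with the root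
  set, because divisibility of integer polynomials by \<open>P\<close> can then be tested on values.\<close>

definition monic_with_roots :: "int poly \<Rightarrow> complex set \<Rightarrow> bool" where
  "monic_with_roots P S \<longleftrightarrow> finite S \<and> map_poly of_int P = (\<Prod>\<zeta>\<in>S. [:-\<zeta>, 1:])"

lemma monic_with_rootsD:
  assumes "monic_with_roots P S"
  shows "finite S" "lead_coeff P = 1" "degree P = card S" "ceval P z = 0 \<longleftrightarrow> z \<in> S"
proof -
  let ?h = "map_poly (of_int :: int \<Rightarrow> complex)"
  from assms have fin: "finite S" and eq: "?h P = (\<Prod>\<zeta>\<in>S. [:-\<zeta>, 1:])"
    by (auto simp: monic_with_roots_def)
  show "finite S" by fact
  have "lead_coeff (?h P) = 1" unfolding eq by (simp add: lead_coeff_prod)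
  then show "lead_coeff P = 1" by simp
  have "degree (?h P) = card S" unfolding eq by (subst degree_prod_eq_sum_degree) auto
  then show "degree P = card S" by simp
  show "ceval P z = 0 \<longleftrightarrow> z \<in> S"
    unfolding ceval_def eq using fin by (auto simp: poly_prod)
qed

text \<open>Division by a monic polynomial stays within the integers, and a remainder that vanishes on \<open>S\<close> has
  more roots than its degree allows.\<close>

lemma monic_with_roots_dvd_iff:
  assumes "monic_with_roots P S"
  shows "P dvd f \<longleftrightarrow> (\<forall>\<zeta>\<in>S. ceval f \<zeta> = 0)"
proof
  assume "P dvd f"
  then obtain q where "f = P * q" by blast
  then show "\<forall>\<zeta>\<in>S. ceval f \<zeta> = 0" using monic_with_rootsD(4)[OF assms] by simp
next
  assume *: "\<forall>\<zeta>\<in>S. ceval f \<zeta> = 0"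
  note P = monic_with_rootsD[OF assms]
  obtain q r where qr: "f = P * q + r" "\<And>i. i \<ge> degree P \<Longrightarrow> coeff r i = 0"
    using monic_division[OF P(2)] by metis
  have roots: "poly (map_poly of_int r) \<zeta> = (0::complex)" if "\<zeta> \<in> S" for \<zeta>
  proof -
    have "ceval r \<zeta> = 0" using *[rule_format, OF that] P(4)[of \<zeta>] that unfolding qr(1) by simp
    then show ?thesis by (simp add: ceval_def)
  qed
  have "map_poly of_int r = (0 :: complex poly)"
  proof (rule ccontr)
    assume nz: "map_poly of_int r \<noteq> (0 :: complex poly)"
    have "card S \<le> card {z. poly (map_poly of_int r) z = (0::complex)}"
      using poly_roots_finite[OF nz] roots by (intro card_mono) auto
    also have "\<dots> \<le> degree (map_poly (of_int :: int \<Rightarrow> complex) r)"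
      by (rule card_poly_roots_bound[OF nz])
    finally have "degree P \<le> degree r" using P(3) by simp
    with qr(2)[of "degree r"] nz show False by simp
  qed
  then have "r = 0" by simp
  with qr(1) show "P dvd f" by simp
qed

lemma monic_with_roots_mult:
  assumes "monic_with_roots P S" "monic_with_roots Q T" "S \<inter> T = {}"
  shows "monic_with_roots (P * Q) (S \<union> T)"
  using assms by (simp add: monic_with_roots_def prod.union_disjoint of_int_poly_hom.hom_mult)

lemma monic_with_roots_prod:
  assumes "finite D" "\<And>d. d \<in> D \<Longrightarrow> monic_with_roots (P d) (S d)"
    and "\<And>d e. d \<in> D \<Longrightarrow> e \<in> D \<Longrightarrow> d \<noteq> e \<Longrightarrow> S d \<inter> S e = {}"
  shows "monic_with_roots (\<Prod>d\<in>D. P d) (\<Union>d\<in>D. S d)"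
  using assms
proof (induction D)
  case empty
  then show ?case by (simp add: monic_with_roots_def)
next
  case (insert d D)
  have "S d \<inter> (\<Union>d\<in>D. S d) = {}"
    using insert.prems(2)[of d] insert.hyps by (fastforce)
  with insert show ?case by (simp add: monic_with_roots_mult)
qed

lemma monic_with_roots_cofactor:
  assumes "monic_with_roots P S" "monic_with_roots (P * Q) T"
  shows "monic_with_roots Q (T - S)"
proof -
  let ?h = "map_poly (of_int :: int \<Rightarrow> complex)"
  have sub: "S \<subseteq> T" using monic_with_rootsD(4)[OF assms(1)] monic_with_rootsD(4)[OF assms(2)] by auto
  have fin: "finite T" using assms(2) by (simp add: monic_with_roots_def)
  have "?h P * ?h Q = (\<Prod>\<zeta>\<in>T. [:-\<zeta>, 1:])"
    using assms(2) by (simp add: monic_with_roots_def of_int_poly_hom.hom_mult)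
  also have "\<dots> = ?h P * (\<Prod>\<zeta>\<in>T - S. [:-\<zeta>, 1:])"
    using assms(1) prod.subset_diff[OF sub fin, of "\<lambda>\<zeta>. [:-\<zeta>, 1:]"]
    by (simp add: monic_with_roots_def mult.commute)
  finally have "?h Q = (\<Prod>\<zeta>\<in>T - S. [:-\<zeta>, 1:])"
    using monic_with_rootsD(2)[OF assms(1)] by auto
  with fin show ?thesis by (simp add: monic_with_roots_def)
qed

section \<open>The index of an ideal of integer polynomials\<close>

definition ideal2 :: "'a::comm_ring_1 \<Rightarrow> 'a \<Rightarrow> 'a set" where
  "ideal2 a b = {u * a + v * b | u v. True}"

lemma ideal2_0: "0 \<in> ideal2 a b"
  and ideal2_add: "p \<in> ideal2 a b \<Longrightarrow> q \<in> ideal2 a b \<Longrightarrow> p + q \<in> ideal2 a b"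
  and ideal2_mult: "p \<in> ideal2 a b \<Longrightarrow> c * p \<in> ideal2 a b"
proof -
  have "0 = 0 * a + 0 * b" by simp
  then show "0 \<in> ideal2 a b" unfolding ideal2_def by blast
next
  assume "p \<in> ideal2 a b" "q \<in> ideal2 a b"
  then obtain u v u' v' where "p = u * a + v * b" "q = u' * a + v' * b"
    unfolding ideal2_def by blast
  then have "p + q = (u + u') * a + (v + v') * b" by (simp add: algebra_simps)
  then show "p + q \<in> ideal2 a b" unfolding ideal2_def by blast
next
  assume "p \<in> ideal2 a b"
  then obtain u v where "p = u * a + v * b" unfolding ideal2_def by blast
  then have "c * p = (c * u) * a + (c * v) * b" by (simp add: algebra_simps)
  then show "c * p \<in> ideal2 a b" unfolding ideal2_def by blast
qed

lemma ideal2_gens: "a \<in> ideal2 a b" "b \<in> ideal2 a b"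
proof -
  have "a = 1 * a + 0 * b" "b = 0 * a + 1 * b" by simp_all
  then show "a \<in> ideal2 a b" "b \<in> ideal2 a b" unfolding ideal2_def by blast+
qed

lemma ideal2_diff: "p \<in> ideal2 a b \<Longrightarrow> q \<in> ideal2 a b \<Longrightarrow> p - q \<in> ideal2 a b"
  using ideal2_add[of p a b "-q"] ideal2_mult[of q a b "-1"] by simp

lemma ideal2_smult: "p \<in> ideal2 a b \<Longrightarrow> smult c p \<in> ideal2 a b"
  using ideal2_mult[of p a b "[:c:]"] by simp

text \<open>A nonzero element \<open>e\<close> of least degree divides a nonzero multiple of each element of the ideal, by
  pseudo-division. Thus a complex root of \<open>e\<close> would be a common root of the generators, and
  \<open>e\<close> must be constant.\<close>

lemma ideal2_contains_const:
  fixes a b :: "int poly"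
  assumes "b \<noteq> 0" and noroot: "\<And>z. \<not> (ceval a z = 0 \<and> ceval b z = 0)"
  obtains N where "N > 0" "[:N:] \<in> ideal2 a b"
proof -
  let ?J = "ideal2 a b"
  obtain e where e: "e \<in> ?J" "e \<noteq> 0" and min: "\<And>f. f \<in> ?J \<Longrightarrow> f \<noteq> 0 \<Longrightarrow> degree e \<le> degree f"
    using arg_min_natI[of "\<lambda>f. f \<in> ?J \<and> f \<noteq> 0" b degree]
      arg_min_nat_le[of "\<lambda>f. f \<in> ?J \<and> f \<noteq> 0" _ degree] ideal2_gens(2)[of b a] assms(1) by metis
  have divides: "\<exists>c q. c \<noteq> 0 \<and> smult c f = e * q" if "f \<in> ?J" for f
  proof -
    obtain q r where qr: "pseudo_divmod f e = (q, r)" by force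
    let ?c = "lead_coeff e ^ (Suc (degree f) - degree e)"
    from pseudo_divmod[OF e(2) qr]
    have eq: "smult ?c f = e * q + r" and r: "r = 0 \<or> degree r < degree e" by auto
    have "r = smult ?c f - q * e" using eq by simp
    then have "r \<in> ?J" using that e(1) by (simp only:) (intro ideal2_diff ideal2_smult ideal2_mult)
    with r min have "r = 0" by fastforce
    with eq e(2) show ?thesis by (intro exI[of _ ?c] exI[of _ q]) simp
  qed
  have "degree e = 0"
  proof (rule ccontr)
    assume "degree e \<noteq> 0"
    then have "\<not> constant (poly (map_poly (of_int :: int \<Rightarrow> complex) e))"
      by (simp add: constant_degree)
    then obtain z where z: "ceval e z = 0"
      using fundamental_theorem_of_algebra unfolding ceval_def by blast
    have "ceval f z = 0" if "f \<in> ?J" for f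
    proof -
      from divides[OF that] obtain c q where "c \<noteq> 0" "smult c f = e * q" by blast
      have "of_int c * ceval f z = ceval (smult c f) z" by simp
      also have "\<dots> = 0" unfolding \<open>smult c f = e * q\<close> using z by simp
      finally show ?thesis using \<open>c \<noteq> 0\<close> by simp
    qed
    with noroot[of z] ideal2_gens[of a b] ideal2_gens[of b a] show False by blast
  qed
  then obtain k where k: "e = [:k:]" by (metis degree_eq_zeroE)
  with e(2) have "k \<noteq> 0" by auto
  have "[:\<bar>k\<bar>:] \<in> ?J" using ideal2_smult[OF e(1), of "sgn k"] k by (simp add: abs_sgn mult.commute)
  with \<open>k \<noteq> 0\<close> show ?thesis by (intro that[of "\<bar>k\<bar>"]) auto
qed

lemma card_image_eq_card_image:
  assumes "\<And>x y. x \<in> A \<Longrightarrow> y \<in> A \<Longrightarrow> f x = f y \<longleftrightarrow> g x = g y"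
  shows "card (f ` A) = card (g ` A)"
proof -
  have *: "g (inv_into A f (f x)) = g x" if "x \<in> A" for x
    using that assms by (metis f_inv_into_f imageI inv_into_into)
  have "bij_betw (\<lambda>y. g (inv_into A f y)) (f ` A) (g ` A)"
    by (rule bij_betw_imageI) (use assms in \<open>auto simp: inj_on_def * image_image\<close>)
  then show ?thesis by (rule bij_betw_same_card)
qed

text \<open>Here \<open>{q. q - p \<in> I}\<close> is the coset \<open>p + I\<close>.\<close>

definition cosets_in :: "'a::ab_group_add set \<Rightarrow> 'a set \<Rightarrow> 'a set set" where
  "cosets_in I T = (\<lambda>p. {q. q - p \<in> I}) ` T"

text \<open>A Hermite normal form of the ideal \<open>J\<close>. The leading coefficients of its elements of degree \<open>i\<close>,
  together with \<open>0\<close>, form an ideal of the integers, and \<open>b i\<close> realizes a generator of it. From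
  degree \<open>s\<close> on this generator is \<open>1\<close>, which makes the quotient finite.\<close>

locale triangular_ideal_basis =
  fixes J :: "int poly set" and s :: nat and b :: "nat \<Rightarrow> int poly"
  assumes J0: "0 \<in> J"
    and J_add: "\<And>p q. p \<in> J \<Longrightarrow> q \<in> J \<Longrightarrow> p + q \<in> J"
    and J_mult: "\<And>p c. p \<in> J \<Longrightarrow> c * p \<in> J"
    and b_in: "\<And>i. b i \<in> J" and b_coeff: "\<And>i j. j > i \<Longrightarrow> coeff (b i) j = 0"
    and b_pos: "\<And>i. coeff (b i) i > 0"
    and b_dvd: "\<And>i p. p \<in> J \<Longrightarrow> (\<And>j. j > i \<Longrightarrow> coeff p j = 0) \<Longrightarrow> coeff (b i) i dvd coeff p i"
    and b_one: "\<And>i. i \<ge> s \<Longrightarrow> coeff (b i) i = 1"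
begin

lemma J_diff: "p \<in> J \<Longrightarrow> q \<in> J \<Longrightarrow> p - q \<in> J"
  using J_add[of p "-q"] J_mult[of q "-1"] by simp

lemma J_smult: "p \<in> J \<Longrightarrow> smult c p \<in> J"
  using J_mult[of p "[:c:]"] by simp

lemma triangular_basis_span:
  assumes "p \<in> J" "\<And>i. i \<ge> n \<Longrightarrow> coeff p i = 0"
  shows "\<exists>w. p = (\<Sum>k<n. smult (w k) (b k))"
  using assms
proof (induction n arbitrary: p)
  case 0
  then have "p = 0" by (intro poly_eqI) auto
  then show ?case by simp
next
  case (Suc n)
  obtain m where m: "coeff p n = coeff (b n) n * m"
    using b_dvd[of p n] Suc.prems by auto
  let ?p = "p - smult m (b n)"
  have "?p \<in> J" using Suc.prems b_in by (intro J_diff J_smult) auto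
  moreover have "coeff ?p i = 0" if "i \<ge> n" for i
    using that Suc.prems(2)[of i] b_coeff[of n i] m by (cases "i = n") auto
  ultimately obtain w where w: "?p = (\<Sum>k<n. smult (w k) (b k))" using Suc.IH by blast
  have "p = ?p + smult m (b n)" by simp
  also have "\<dots> = (\<Sum>k<Suc n. smult ((w(n := m)) k) (b k))" unfolding w by simp
  finally show ?case by blast
qed

text \<open>Subtracting multiples of the \<open>b i\<close>, from the highest degree downwards, replaces each coefficient by
  its remainder modulo the leading coefficient of \<open>b i\<close>.\<close>

lemma reduced_representative:
  assumes "\<And>i. i \<ge> n \<Longrightarrow> coeff p i = 0"
  shows "\<exists>q. p - q \<in> J \<and> (\<forall>i<n. 0 \<le> coeff q i \<and> coeff q i < coeff (b i) i) \<and> (\<forall>i\<ge>n. coeff q i = 0)"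
  using assms
proof (induction n arbitrary: p)
  case 0
  then have "p = 0" by (intro poly_eqI) auto
  then show ?case using J0 by (intro exI[of _ 0]) auto
next
  case (Suc n)
  let ?c = "coeff (b n) n"
  let ?d = "coeff p n div ?c" and ?e = "coeff p n mod ?c"
  let ?p = "p - smult ?d (b n) - monom ?e n"
  have "coeff ?p i = 0" if "i \<ge> n" for i
    using that Suc.prems[of i] b_coeff[of n i]
    by (cases "i = n") (auto simp: minus_mod_eq_div_mult [symmetric])
  from Suc.IH[OF this] obtain q where q: "?p - q \<in> J"
    "\<forall>i<n. 0 \<le> coeff q i \<and> coeff q i < coeff (b i) i" "\<forall>i\<ge>n. coeff q i = 0"
    by blast
  have "p - (q + monom ?e n) = (?p - q) + smult ?d (b n)" by simp
  also have "\<dots> \<in> J" using q b_in by (intro J_add J_smult)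
  finally show ?case using q b_pos[of n]
    by (intro exI[of _ "q + monom ?e n"]) (auto simp: less_Suc_eq)
qed

text \<open>Reduced polynomials represent each coset once: the leading coefficient of a nonzero difference of
  two of them is too small to be divisible by that of the corresponding \<open>b i\<close>.\<close>

lemma card_cosets_triangular: "int (card (cosets_in J UNIV)) = (\<Prod>i<s. coeff (b i) i)"
proof -
  let ?c = "\<lambda>i. coeff (b i) i"
  let ?R = "{p. \<forall>i. 0 \<le> coeff p i \<and> coeff p i < ?c i}"
  let ?C = "\<lambda>p. {q. q - p \<in> J}"
  have R0: "coeff p i = 0" if "p \<in> ?R" "i \<ge> s" for p i
    using that b_one[of i] by (auto dest: spec[of _ i])
  have "bij_betw ?C ?R (cosets_in J UNIV)"
  proof (rule bij_betw_imageI)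
    show "inj_on ?C ?R"
    proof (rule inj_onI)
      fix p q assume p: "p \<in> ?R" and q: "q \<in> ?R" and eq: "?C p = ?C q"
      have "p \<in> ?C p" using J0 by simp
      then have mem: "p - q \<in> J" unfolding eq by simp
      show "p = q"
      proof (rule ccontr)
        assume "p \<noteq> q"
        define n where "n = degree (p - q)"
        have nz: "coeff (p - q) n \<noteq> 0"
          using \<open>p \<noteq> q\<close> unfolding n_def leading_coeff_0_iff by simp
        have "?c n dvd coeff (p - q) n"
          by (intro b_dvd[OF mem] coeff_eq_0) (simp add: n_def)
        then have "?c n \<le> \<bar>coeff (p - q) n\<bar>" using nz by (meson dvd_imp_le_int order_trans abs_ge_self)
        moreover have "0 \<le> coeff p n \<and> coeff p n < ?c n" "0 \<le> coeff q n \<and> coeff q n < ?c n"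
          using p q by auto
        ultimately show False unfolding coeff_diff by linarith
      qed
    qed
    show "?C ` ?R = cosets_in J UNIV"
    proof -
      have "\<exists>q\<in>?R. ?C p = ?C q" for p
      proof -
        obtain q where q: "p - q \<in> J"
          "\<forall>i<Suc (degree p). 0 \<le> coeff q i \<and> coeff q i < ?c i" "\<forall>i\<ge>Suc (degree p). coeff q i = 0"
          using reduced_representative[of "Suc (degree p)" p] by (auto simp: coeff_eq_0)
        have "q \<in> ?R" using q(2,3) b_pos by (auto simp: not_less) (metis linorder_not_less order_refl)+
        moreover have "?C p = ?C q"
        proof (intro equalityI subsetI)
          fix x assume "x \<in> ?C p"
          then show "x \<in> ?C q" using J_add[OF _ q(1), of "x - p"] by simp
        next
          fix x assume "x \<in> ?C q"
          then show "x \<in> ?C p" using J_diff[OF _ q(1), of "x - q"] by simp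
        qed
        ultimately show ?thesis by blast
      qed
      then show ?thesis unfolding cosets_in_def by blast
    qed
  qed
  then have "card (cosets_in J UNIV) = card ?R" by (simp add: bij_betw_same_card)
  also have "bij_betw (\<lambda>p. restrict (coeff p) {..<s}) ?R (PiE {..<s} (\<lambda>i. {0..<?c i}))"
  proof (rule bij_betw_imageI)
    show "inj_on (\<lambda>p. restrict (coeff p) {..<s}) ?R"
    proof (rule inj_onI, rule poly_eqI)
      fix p q i assume p: "p \<in> ?R" and q: "q \<in> ?R"
        and eq: "restrict (coeff p) {..<s} = restrict (coeff q) {..<s}"
      show "coeff p i = coeff q i"
      proof (cases "i < s")
        case True
        then show ?thesis using fun_cong[OF eq, of i] by simp
      next
        case False
        then show ?thesis using R0[OF p, of i] R0[OF q, of i] by simp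
      qed
    qed
    show "(\<lambda>p. restrict (coeff p) {..<s}) ` ?R = PiE {..<s} (\<lambda>i. {0..<?c i})"
    proof (intro equalityI subsetI)
      fix h assume h: "h \<in> PiE {..<s} (\<lambda>i. {0..<?c i})"
      define p where "p = (\<Sum>i<s. monom (h i) i)"
      have cp: "coeff p i = (if i < s then h i else 0)" for i by (simp add: p_def coeff_sum)
      have "p \<in> ?R" using h b_pos by (auto simp: cp PiE_def Pi_def)
      moreover have "h = restrict (coeff p) {..<s}"
        using h by (auto simp: cp PiE_def extensional_def restrict_def)
      ultimately show "h \<in> (\<lambda>p. restrict (coeff p) {..<s}) ` ?R" by blast
    qed (auto simp: PiE_def Pi_def)
  qed
  then have "card ?R = card (PiE {..<s} (\<lambda>i. {0..<?c i}))" by (rule bij_betw_same_card)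
  also have "\<dots> = (\<Prod>i<s. nat (?c i))" by (simp add: card_PiE)
  finally show ?thesis using b_pos by (simp add: less_imp_le)
qed

end

text \<open>Among the elements of degree \<open>i\<close> with positive leading coefficient, which exist because
  of the constant \<open>N\<close>, choose one that minimizes it; Euclidean division shows that this minimum divides
  all the others.\<close>

lemma ideal_triangular_basis:
  fixes J :: "int poly set"
  assumes J_add: "\<And>p q. p \<in> J \<Longrightarrow> q \<in> J \<Longrightarrow> p + q \<in> J"
    and J_mult: "\<And>p c. p \<in> J \<Longrightarrow> c * p \<in> J"
    and const: "[:N:] \<in> J" "N > 0"
  obtains b where "\<And>i. b i \<in> J" "\<And>i j. j > i \<Longrightarrow> coeff (b i) j = 0"
    "\<And>i. coeff (b i) i > 0"
    "\<And>i p. p \<in> J \<Longrightarrow> (\<And>j. j > i \<Longrightarrow> coeff p j = 0) \<Longrightarrow> coeff (b i) i dvd coeff p i"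
proof -
  let ?L = "\<lambda>i p. p \<in> J \<and> (\<forall>j>i. coeff p j = 0)"
  have "\<exists>b. ?L i b \<and> coeff b i > 0 \<and> (\<forall>p. ?L i p \<longrightarrow> coeff b i dvd coeff p i)" for i
  proof -
    let ?P = "\<lambda>p. ?L i p \<and> coeff p i > 0"
    have "?P (monom N i)"
      using J_mult[OF const(1), of "monom 1 i"] const(2) by (simp add: smult_monom)
    then have "\<exists>b. ?P b \<and> (\<forall>p. ?P p \<longrightarrow> nat (coeff b i) \<le> nat (coeff p i))"
      by (rule ex_has_least_nat)
    then obtain b where b: "?P b" and min: "\<And>p. ?P p \<Longrightarrow> nat (coeff b i) \<le> nat (coeff p i)"
      by blast
    have "coeff b i dvd coeff p i" if p: "?L i p" for p
    proof (rule ccontr)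
      assume nd: "\<not> coeff b i dvd coeff p i"
      let ?q = "p + [:- (coeff p i div coeff b i):] * b"
      have "?L i ?q" using p b by (intro conjI J_add J_mult) auto
      moreover have cq: "coeff ?q i = coeff p i mod coeff b i"
        by (simp add: minus_div_mult_eq_mod)
      moreover have "coeff p i mod coeff b i > 0"
        using nd b by (simp add: dvd_eq_mod_eq_0 order_less_le)
      ultimately have "nat (coeff b i) \<le> nat (coeff p i mod coeff b i)" using min[of ?q] by simp
      moreover have "coeff p i mod coeff b i < coeff b i" using b by simp
      ultimately show False using b by linarith
    qed
    with b show ?thesis by blast
  qed
  then obtain b where "\<And>i. ?L i (b i) \<and> coeff (b i) i > 0 \<and> (\<forall>p. ?L i p \<longrightarrow> coeff (b i) i dvd coeff p i)"
    using choice[of "\<lambda>i b. ?L i b \<and> coeff b i > 0 \<and> (\<forall>p. ?L i p \<longrightarrow> coeff b i dvd coeff p i)"]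
    by blast
  then show ?thesis by (intro that[of b]) auto
qed

text \<open>A vector in the kernel of the transpose is the coefficient vector of a polynomial of degree less
  than \<open>s\<close> with \<open>s\<close> distinct roots.\<close>

lemma vandermonde_det_nonzero:
  fixes z :: "nat \<Rightarrow> complex"
  assumes inj: "inj_on z {..<s}"
  shows "det (mat s s (\<lambda>(i, j). z j ^ i)) \<noteq> 0"
proof
  let ?V = "mat s s (\<lambda>(i, j). z j ^ i)"
  assume "det ?V = 0"
  then have "det (transpose_mat ?V) = 0" by (subst det_transpose[of _ s]) auto
  then obtain v where v: "v \<in> carrier_vec s" "v \<noteq> 0\<^sub>v s" "transpose_mat ?V *\<^sub>v v = 0\<^sub>v s"
    using det_0_iff_vec_prod_zero_field[of "transpose_mat ?V" s] by auto
  define p where "p = (\<Sum>i<s. monom (v $ i) i)"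
  have cp: "coeff p i = (if i < s then v $ i else 0)" for i by (simp add: p_def coeff_sum)
  have root: "poly p (z j) = 0" if "j < s" for j
  proof -
    have "0 = (transpose_mat ?V *\<^sub>v v) $ j" using v that by simp
    also have "\<dots> = (\<Sum>i<s. z j ^ i * v $ i)"
      using that v(1) by (auto simp: scalar_prod_def lessThan_atLeast0 intro!: sum.cong)
    also have "\<dots> = poly p (z j)" by (simp add: p_def poly_sum poly_monom mult.commute)
    finally show ?thesis by simp
  qed
  have nz: "p \<noteq> 0"
  proof
    assume "p = 0"
    then have "v $ i = 0" if "i < s" for i using cp[of i] that by simp
    with v show False by (auto intro!: eq_vecI)
  qed
  have "s = card (z ` {..<s})" using inj by (simp add: card_image)
  also have "\<dots> \<le> card {x. poly p x = 0}"
    using poly_roots_finite[OF nz] root by (intro card_mono) auto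
  also have "\<dots> \<le> degree p" by (rule card_poly_roots_bound[OF nz])
  finally have "coeff p (degree p) = 0" by (simp add: cp)
  with nz show False by simp
qed

text \<open>The matrix of values is the matrix of coefficients times the Vandermonde matrix.\<close>

lemma det_evaluations:
  fixes f :: "nat \<Rightarrow> int poly" and z :: "nat \<Rightarrow> complex"
  assumes "\<And>i k. i < s \<Longrightarrow> k \<ge> s \<Longrightarrow> coeff (f i) k = 0"
  shows "det (mat s s (\<lambda>(i, j). ceval (f i) (z j))) =
    of_int (det (mat s s (\<lambda>(i, k). coeff (f i) k))) * det (mat s s (\<lambda>(i, j). z j ^ i))"
proof -
  let ?C = "mat s s (\<lambda>(i, k). coeff (f i) k)" and ?V = "mat s s (\<lambda>(i, j). z j ^ i)"
  have "mat s s (\<lambda>(i, j). ceval (f i) (z j)) = map_mat of_int ?C * ?V"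
    using assms by (intro eq_matI) (auto simp: scalar_prod_def lessThan_atLeast0 ceval_eq_sum[of s])
  then show ?thesis
    by (simp add: det_mult[of _ s] of_int_hom.hom_det)
qed

text \<open>The order of \<open>\<int>[t] / (g, \<Psi>)\<close> is the modulus of the resultant. Let \<open>V\<close> be the Vandermonde matrix of
  the roots of \<open>\<Psi>\<close>, \<open>D\<close> the diagonal matrix of the values of \<open>g\<close> there, and \<open>B\<close> the coefficient matrix
  of a triangular basis of the ideal. Expressing the \<open>b i\<close> through multiples of \<open>g\<close> and the
  \<open>t ^ i g\<close> through the \<open>b i\<close>, modulo \<open>\<Psi>\<close>, gives integer matrices with \<open>B V = U V D\<close> and
  \<open>V D = W B V\<close>. Since \<open>V D\<close> is invertible, \<open>det U\<close> is \<open>1\<close> or \<open>-1\<close>, and \<open>\<bar>det B\<bar> = \<bar>det D\<bar>\<close>.\<close>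

theorem card_cosets_ideal2:
  assumes \<Psi>: "monic_with_roots \<Psi> Z" and nz: "\<And>\<zeta>. \<zeta> \<in> Z \<Longrightarrow> ceval g \<zeta> \<noteq> 0"
  shows "real (card (cosets_in (ideal2 g \<Psi>) UNIV)) = cmod (\<Prod>\<zeta>\<in>Z. ceval g \<zeta>)"
proof -
  let ?J = "ideal2 g \<Psi>"
  note R = monic_with_rootsD[OF \<Psi>]
  define s where "s = card Z"
  have degP: "degree \<Psi> = s" using R(3) by (simp add: s_def)
  have "\<Psi> \<noteq> 0" using R(2) by auto
  then obtain N where N: "N > 0" "[:N:] \<in> ?J"
    using ideal2_contains_const[of \<Psi> g] nz R(4) by blast
  obtain b where b_in: "\<And>i. b i \<in> ?J" and b_coeff: "\<And>i j. j > i \<Longrightarrow> coeff (b i) j = 0"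
    and b_pos: "\<And>i. coeff (b i) i > 0"
    and b_dvd: "\<And>i p. p \<in> ?J \<Longrightarrow> (\<And>j. j > i \<Longrightarrow> coeff p j = 0) \<Longrightarrow> coeff (b i) i dvd coeff p i"
    using ideal_triangular_basis[OF ideal2_add ideal2_mult N(2,1)] by metis
  have b_one: "coeff (b i) i = 1" if "i \<ge> s" for i
  proof -
    let ?p = "monom 1 (i - s) * \<Psi>"
    have "?p \<in> ?J" by (intro ideal2_mult ideal2_gens)
    moreover have "coeff ?p j = 0" if "j > i" for j
      using that \<open>i \<ge> s\<close> degP by (simp add: coeff_monom_mult coeff_eq_0)
    moreover have "coeff ?p i = 1"
      using that degP R(2) by (simp add: coeff_monom_mult)
    ultimately have "coeff (b i) i dvd 1" using b_dvd[of ?p i] by simp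
    with b_pos[of i] show ?thesis by simp
  qed
  interpret T: triangular_ideal_basis ?J s b
    by (rule triangular_ideal_basis.intro
        [OF ideal2_0 ideal2_add ideal2_mult b_in b_coeff b_pos b_dvd b_one])
  have card: "int (card (cosets_in ?J UNIV)) = (\<Prod>i<s. coeff (b i) i)"
    by (rule T.card_cosets_triangular)
  obtain z where z: "bij_betw z {..<s} Z"
    using ex_bij_betw_nat_finite[OF R(1)] by (auto simp: s_def lessThan_atLeast0)
  have zZ: "z j \<in> Z" if "j < s" for j using z that by (auto simp: bij_betw_def)
  let ?ev = "\<lambda>f. mat s s (\<lambda>(i, j). ceval (f i) (z j))"
  let ?cf = "\<lambda>f. mat s s (\<lambda>(i, k). coeff (f i) k) :: int mat"
  define V where "V = mat s s (\<lambda>(i, j). z j ^ i)"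
  define D where "D = mat s s (\<lambda>(i, j). if i = j then ceval g (z j) else 0)"
  have detV: "det V \<noteq> 0"
    unfolding V_def using z by (intro vandermonde_det_nonzero) (auto simp: bij_betw_def)
  have "det D = prod_list (diag_mat D)"
    by (rule det_upper_triangular[of _ s]) (auto simp: D_def upper_triangular_def)
  also have "\<dots> = (\<Prod>j<s. ceval g (z j))"
    unfolding prod_list_diag_prod by (auto simp: D_def lessThan_atLeast0 intro!: prod.cong)
  also have "\<dots> = (\<Prod>\<zeta>\<in>Z. ceval g \<zeta>)" by (rule prod.reindex_bij_betw[OF z])
  finally have detD: "det D = (\<Prod>\<zeta>\<in>Z. ceval g \<zeta>)" .
  then have detD0: "det D \<noteq> 0" using nz R(1) by auto
  have "det (?cf b) = prod_list (diag_mat (?cf b))"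
    by (rule det_lower_triangular[of s]) (auto simp: b_coeff)
  also have "\<dots> = (\<Prod>i<s. coeff (b i) i)"
    unfolding prod_list_diag_prod by (auto simp: lessThan_atLeast0 intro!: prod.cong)
  finally have detB: "det (?cf b) = (\<Prod>i<s. coeff (b i) i)" .
  have "\<exists>u. (\<forall>k\<ge>s. coeff u k = 0) \<and> (\<forall>\<zeta>\<in>Z. ceval (b i) \<zeta> = ceval u \<zeta> * ceval g \<zeta>)" for i
  proof -
    obtain x y where xy: "b i = x * g + y * \<Psi>" using b_in[of i] unfolding ideal2_def by blast
    obtain q u where qu: "x = \<Psi> * q + u" "\<And>k. k \<ge> degree \<Psi> \<Longrightarrow> coeff u k = 0"
      using monic_division[OF R(2)] by metis
    have "ceval \<Psi> \<zeta> = 0" if "\<zeta> \<in> Z" for \<zeta> using R(4) that by blast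
    then show ?thesis using qu by (intro exI[of _ u]) (simp add: xy degP)
  qed
  then obtain u where u: "\<And>i k. k \<ge> s \<Longrightarrow> coeff (u i) k = 0"
    "\<And>i \<zeta>. \<zeta> \<in> Z \<Longrightarrow> ceval (b i) \<zeta> = ceval (u i) \<zeta> * ceval g \<zeta>"
    by metis
  \<comment> \<open>Reducing \<open>t ^ i g\<close> modulo \<open>\<Psi>\<close> keeps it in the ideal and does not change its values on \<open>Z\<close>.\<close>
  have "\<exists>w. \<forall>\<zeta>\<in>Z. \<zeta> ^ i * ceval g \<zeta> = (\<Sum>k<s. of_int (w k) * ceval (b k) \<zeta>)" for i
  proof -
    obtain q v where qv: "monom 1 i * g = \<Psi> * q + v" "\<And>k. k \<ge> degree \<Psi> \<Longrightarrow> coeff v k = 0"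
      using monic_division[OF R(2)] by metis
    have "v = monom 1 i * g - q * \<Psi>" using qv(1) by (simp add: mult.commute)
    then have "v \<in> ?J" by (simp only:) (intro ideal2_diff ideal2_mult ideal2_gens)
    then obtain w where w: "v = (\<Sum>k<s. smult (w k) (b k))"
      using T.triangular_basis_span[of v s] \<open>v \<in> ?J\<close> qv(2) degP by blast
    have "\<zeta> ^ i * ceval g \<zeta> = ceval v \<zeta>" if "\<zeta> \<in> Z" for \<zeta>
    proof -
      have "\<zeta> ^ i * ceval g \<zeta> = ceval (monom 1 i * g) \<zeta>" by simp
      also have "\<dots> = ceval v \<zeta>" unfolding qv(1) using R(4)[of \<zeta>] that by simp
      finally show ?thesis .
    qed
    then show ?thesis by (intro exI[of _ w]) (simp add: w ceval_sum)
  qed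
  then obtain w where w: "\<And>i \<zeta>. \<zeta> \<in> Z \<Longrightarrow> \<zeta> ^ i * ceval g \<zeta> = (\<Sum>k<s. of_int (w i k) * ceval (b k) \<zeta>)"
    by metis
  define W where "W = mat s s (\<lambda>(i, k). w i k)"
  have "?ev b = ?ev u * D"
  proof (intro eq_matI)
    fix i j assume "i < dim_row (?ev u * D)" "j < dim_col (?ev u * D)"
    then have ij: "i < s" "j < s" by (auto simp: D_def)
    have "(?ev u * D) $$ (i, j) = (\<Sum>k<s. if k = j then ceval (u i) (z k) * ceval g (z k) else 0)"
      using ij by (simp add: D_def scalar_prod_def lessThan_atLeast0 if_distrib cong: if_cong)
    also have "\<dots> = ?ev b $$ (i, j)" using ij u(2)[OF zZ] by simp
    finally show "?ev b $$ (i, j) = (?ev u * D) $$ (i, j)" ..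
  qed (auto simp: D_def)
  then have "det (?ev b) = det (?ev u) * det D" by (simp add: det_mult[of _ s] D_def)
  then have BU: "det (?ev b) = of_int (det (?cf u)) * det V * det D"
    using det_evaluations[of s u z] u(1) by (simp add: V_def)
  have "V * D = map_mat of_int W * ?ev b"
  proof (intro eq_matI)
    fix i j assume "i < dim_row (map_mat of_int W * ?ev b)" "j < dim_col (map_mat of_int W * ?ev b)"
    then have ij: "i < s" "j < s" by (auto simp: W_def)
    have "(V * D) $$ (i, j) = (\<Sum>k<s. if k = j then z k ^ i * ceval g (z k) else 0)"
      using ij by (simp add: V_def D_def scalar_prod_def lessThan_atLeast0 if_distrib cong: if_cong)
    also have "\<dots> = (\<Sum>k<s. of_int (w i k) * ceval (b k) (z j))" using ij w[OF zZ] by simp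
    also have "\<dots> = (map_mat of_int W * ?ev b) $$ (i, j)"
      using ij by (auto simp: W_def scalar_prod_def lessThan_atLeast0 intro!: sum.cong)
    finally show "(V * D) $$ (i, j) = (map_mat of_int W * ?ev b) $$ (i, j)" .
  qed (auto simp: V_def D_def W_def)
  then have "det (V * D) = det (map_mat of_int W * ?ev b)" by simp
  then have VW: "det V * det D = of_int (det W) * det (?ev b)"
    by (simp add: det_mult[of _ s] V_def D_def W_def of_int_hom.hom_det)
  have "of_int (det W * det (?cf u)) * (det V * det D) = det V * det D"
    using VW BU by (metis mult.assoc of_int_mult)
  then have "of_int (det W * det (?cf u)) = (1 :: complex)" using detV detD0 by simp
  then have "det W * det (?cf u) = 1" by (simp only: of_int_eq_1_iff)
  then have unit: "\<bar>det (?cf u)\<bar> = 1" by (metis dvd_triv_right zdvd1_eq)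
  have "of_int (det (?cf b)) * det V = of_int (det (?cf u)) * det V * det D"
    using BU det_evaluations[of s b z] b_coeff by (simp add: V_def)
  then have "of_int (det (?cf b)) = of_int (det (?cf u)) * det D" using detV by simp
  then have "cmod (of_int (det (?cf b))) = cmod (of_int (det (?cf u)) * det D)" by simp
  then have "\<bar>of_int (det (?cf b))\<bar> = \<bar>real_of_int (det (?cf u))\<bar> * cmod (det D)"
    by (simp add: norm_mult)
  then have "\<bar>real_of_int (det (?cf b))\<bar> = cmod (det D)"
    using unit by (metis mult_1 of_int_1 of_int_abs)
  moreover have "det (?cf b) = int (card (cosets_in ?J UNIV))" using card detB by simp
  ultimately show ?thesis using detD by simp
qed

section \<open>Irreducibility of the cyclotomic polynomials\<close>

lemma prime_dvd_power_add:
  fixes x y :: "'a::comm_ring_1"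
  assumes "prime p"
  shows "of_nat p dvd (x + y) ^ p - x ^ p - y ^ p"
proof -
  have p: "p > 0" using assms by (simp add: prime_gt_0_nat)
  have "(x + y) ^ p = (\<Sum>k\<le>p. of_nat (p choose k) * x ^ k * y ^ (p - k))"
    by (rule binomial_ring)
  also have "{..p} = insert 0 (insert p {1..<p})" using p by auto
  finally have "(x + y) ^ p - x ^ p - y ^ p = (\<Sum>k\<in>{1..<p}. of_nat (p choose k) * x ^ k * y ^ (p - k))"
    using p by (simp add: algebra_simps)
  also have "of_nat p dvd \<dots>"
  proof (intro dvd_sum)
    fix k assume "k \<in> {1..<p}"
    then have "p dvd p choose k" using assms p by (intro dvd_choose_prime) auto
    then have "(of_nat p :: 'a) dvd of_nat (p choose k)" by (auto simp: dvd_def)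
    then show "(of_nat p :: 'a) dvd of_nat (p choose k) * x ^ k * y ^ (p - k)" by simp
  qed
  finally show ?thesis .
qed

lemma prime_dvd_power_diff_int:
  assumes "prime p"
  shows "int p dvd a ^ p - a"
proof -
  have p: "p > 0" using assms by (simp add: prime_gt_0_nat)
  have nat: "int p dvd int n ^ p - int n" for n
  proof (induction n)
    case (Suc n)
    have "int p dvd ((int n + 1) ^ p - int n ^ p - 1 ^ p) + (int n ^ p - int n)"
      using prime_dvd_power_add[OF assms, of "int n" 1] Suc by (intro dvd_add) simp_all
    then show ?case by (simp add: algebra_simps)
  qed (use p in \<open>simp add: zero_power\<close>)
  define n where "n = nat (a mod int p)"
  have "[int n = a] (mod int p)" using p by (simp add: n_def cong_def)
  then have "[int n ^ p - int n = a ^ p - a] (mod int p)" by (intro cong_diff cong_pow)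
  then show ?thesis using nat[of n] cong_dvd_iff by blast
qed

text \<open>The Frobenius map modulo \<open>p\<close> is a ring homomorphism that fixes the constants.\<close>

lemma frobenius_int_poly:
  fixes f :: "int poly"
  assumes "prime p"
  shows "of_nat p dvd pcompose f (monom 1 p) - f ^ p"
proof (induction f)
  case 0
  then show ?case using assms by (simp add: prime_gt_0_nat zero_power)
next
  case (pCons a f)
  let ?X = "monom (1::int) 1"
  have eq: "pCons a f = [:a:] + ?X * f" by (simp add: monom_altdef)
  have "pcompose (pCons a f) (monom 1 p) - pCons a f ^ p
     = ?X ^ p * (pcompose f (monom 1 p) - f ^ p) - [:a ^ p - a:]
       - (([:a:] + ?X * f) ^ p - [:a:] ^ p - (?X * f) ^ p)"
    unfolding eq[symmetric] by (simp add: pcompose_pCons monom_power algebra_simps poly_const_pow)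
  moreover have "of_nat p dvd [:a ^ p - a:]"
  proof -
    from prime_dvd_power_diff_int[OF assms, of a] obtain c where "a ^ p - a = int p * c" by blast
    then have "[:a ^ p - a:] = of_nat p * [:c:]" by (simp add: of_nat_poly)
    then show ?thesis by (rule dvdI)
  qed
  ultimately show ?case
    using pCons.IH prime_dvd_power_add[OF assms, of "[:a:]" "?X * f"]
    by (simp only:) (rule dvd_diff[OF dvd_diff[OF dvd_mult]]; assumption)
qed

text \<open>A polynomial \<open>e\<close> of least degree that vanishes at \<open>\<zeta>\<close> may be taken primitive. It then divides over the
  integers, by Gauss's lemma, every \<open>f\<close> that vanishes at \<open>\<zeta>\<close>, and as it divides the monic \<open>f0\<close> its
  leading coefficient is a unit.\<close>

lemma integral_minimal_polynomial:
  fixes f0 :: "int poly"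
  assumes "lead_coeff f0 = 1" "ceval f0 \<zeta> = 0"
  obtains e where "lead_coeff e = 1" "\<And>f. ceval f \<zeta> = 0 \<longleftrightarrow> e dvd f"
proof -
  let ?P = "\<lambda>f. ceval f \<zeta> = 0 \<and> f \<noteq> 0"
  have "?P f0" using assms by auto
  then have "\<exists>e. ?P e \<and> (\<forall>f. ?P f \<longrightarrow> degree e \<le> degree f)" by (rule ex_has_least_nat)
  then obtain e0 where e0: "?P e0" and min0: "\<And>f. ?P f \<Longrightarrow> degree e0 \<le> degree f" by blast
  define e1 where "e1 = primitive_part e0"
  have "e0 = smult (content e0) e1" by (simp add: e1_def)
  then have "of_int (content e0) * ceval e1 \<zeta> = ceval e0 \<zeta>" by (metis ceval_simps(7))
  then have e1: "?P e1" using e0 by (simp add: e1_def)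
  have cont: "content e1 = 1" using e0 by (simp add: e1_def)
  have min: "degree e1 \<le> degree f" if "?P f" for f using min0[OF that] by (simp add: e1_def)
  have dvd: "e1 dvd f" if f: "ceval f \<zeta> = 0" for f
  proof -
    obtain q r where qr: "pseudo_divmod f e1 = (q, r)" by force
    define c where "c = lead_coeff e1 ^ (Suc (degree f) - degree e1)"
    have c0: "c \<noteq> 0" using e1 by (simp add: c_def)
    from e1 pseudo_divmod[of e1 f q r] qr
    have eq: "smult c f = e1 * q + r" and r: "r = 0 \<or> degree r < degree e1" by (auto simp: c_def)
    have "ceval (smult c f) \<zeta> = ceval r \<zeta>" unfolding eq using e1 by simp
    then have "ceval r \<zeta> = 0" using f by simp
    with min[of r] r have "r = 0" by fastforce
    with eq have eq: "smult c f = e1 * q" by simp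
    have "c dvd content (smult c f)" by (simp add: content_smult)
    also have "content (smult c f) = content q" unfolding eq by (simp add: content_mult cont)
    finally have "[:c:] dvd q" by (simp add: const_poly_dvd_iff_dvd_content)
    then obtain q' where "q = [:c:] * q'" by blast
    with eq have "smult c f = smult c (e1 * q')" by simp
    with c0 have "f = e1 * q'" by (metis smult_cancel)
    then show ?thesis by simp
  qed
  have "lead_coeff e1 dvd lead_coeff f0"
    using dvd[OF assms(2)] by (auto simp: dvd_def lead_coeff_mult)
  then have u: "lead_coeff e1 = 1 \<or> lead_coeff e1 = -1" using assms(1) by auto
  define e where "e = smult (lead_coeff e1) e1"
  show ?thesis
  proof (rule that[of e])
    show "lead_coeff e = 1" using u by (auto simp: e_def)
    have "e dvd f \<longleftrightarrow> e1 dvd f" for f using u by (auto simp: e_def)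
    moreover have "e1 dvd f \<longleftrightarrow> ceval f \<zeta> = 0" for f using dvd e1 by auto
    ultimately show "ceval f \<zeta> = 0 \<longleftrightarrow> e dvd f" for f by blast
  qed
qed

text \<open>Let \<open>e\<close> be the minimal polynomial of \<open>\<zeta>\<close>. The value \<open>e(\<zeta> ^ p)\<close> depends only on \<open>p\<close> modulo \<open>d\<close>, so only
  finitely many remainders of \<open>e(t ^ p)\<close> modulo \<open>e\<close> occur; let \<open>A\<close> bound their coefficients. For prime
  \<open>p\<close>, on the other hand, \<open>e(t ^ p)\<close> is congruent to \<open>e(t) ^ p\<close> modulo \<open>p\<close>, so that the remainder is
  divisible by \<open>p\<close>. If \<open>p > A\<close>, it is zero.\<close>

lemma conjugate_by_large_prime:
  assumes "\<zeta> ^ d = 1" "d > 0"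
  obtains A where "\<And>p f. prime p \<Longrightarrow> p > A \<Longrightarrow> ceval f \<zeta> = 0 \<Longrightarrow> ceval f (\<zeta> ^ p) = 0"
proof -
  have "degree (monom 1 d - 1 :: int poly) = d"
    using assms(2) unfolding diff_conv_add_uminus
    by (subst degree_add_eq_left) (auto simp: degree_monom_eq)
  then have "lead_coeff (monom 1 d - 1 :: int poly) = 1" using assms(2) by simp
  then obtain e where e: "lead_coeff e = 1" "\<And>f. ceval f \<zeta> = 0 \<longleftrightarrow> e dvd f"
    using integral_minimal_polynomial[of "monom 1 d - 1" \<zeta>] assms(1) by auto
  have "\<exists>r. e dvd pcompose e (monom 1 k) - r \<and> (\<forall>i\<ge>degree e. coeff r i = 0)" for k
  proof -
    obtain q r where "pcompose e (monom 1 k) = e * q + r" "\<And>i. i \<ge> degree e \<Longrightarrow> coeff r i = 0"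
      using monic_division[OF e(1)] by metis
    then show ?thesis by (intro exI[of _ r]) auto
  qed
  then obtain R where R: "\<And>k. e dvd pcompose e (monom 1 k) - R k"
    "\<And>k i. i \<ge> degree e \<Longrightarrow> coeff (R k) i = 0" by metis
  define A where "A = (\<Sum>k<d. \<Sum>i<degree e. nat \<bar>coeff (R k) i\<bar>)"
  have bound: "\<bar>coeff (R k) i\<bar> \<le> int A" if "k < d" for k i
  proof (cases "i < degree e")
    case True
    have "nat \<bar>coeff (R k) i\<bar> \<le> (\<Sum>i<degree e. nat \<bar>coeff (R k) i\<bar>)"
      using True by (intro member_le_sum) auto
    also have "\<dots> \<le> A" unfolding A_def
      using that by (intro member_le_sum[of k "{..<d}" "\<lambda>k. \<Sum>i<degree e. nat \<bar>coeff (R k) i\<bar>"]) auto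
    finally show ?thesis by linarith
  next
    case False
    then show ?thesis using R(2)[of i k] by simp
  qed
  have evR: "ceval (R k) \<zeta> = ceval e (\<zeta> ^ k)" for k
    using R(1)[of k] e(2)[of "pcompose e (monom 1 k) - R k"] by (simp add: ceval_pcompose)
  have main: "ceval e (\<zeta> ^ p) = 0" if p: "prime p" "p > A" for p
  proof -
    define k where "k = p mod d"
    have k: "k < d" using assms(2) by (simp add: k_def)
    have "\<zeta> ^ p = (\<zeta> ^ d) ^ (p div d) * \<zeta> ^ k"
      unfolding k_def by (simp flip: power_mult power_add)
    then have pk: "\<zeta> ^ p = \<zeta> ^ k" using assms(1) by simp
    from frobenius_int_poly[OF p(1), of e] obtain q
      where q: "pcompose e (monom 1 p) - e ^ p = of_nat p * q" by blast
    obtain h S where S: "q = e * h + S" "\<And>i. i \<ge> degree e \<Longrightarrow> coeff S i = 0"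
      using monic_division[OF e(1)] by metis
    have e0: "ceval e \<zeta> = 0" using e(2)[of e] by simp
    have "ceval e (\<zeta> ^ p) = ceval (pcompose e (monom 1 p) - e ^ p) \<zeta>"
      using e0 p(1) by (simp add: ceval_pcompose prime_gt_0_nat)
    also have "\<dots> = ceval (of_nat p * S) \<zeta>" unfolding q S(1) using e0 by simp
    finally have "ceval (R k - of_nat p * S) \<zeta> = 0" using evR[of k] pk by simp
    then have dv: "e dvd R k - of_nat p * S" using e(2) by blast
    have cz: "coeff (R k - of_nat p * S) i = 0" if "i \<ge> degree e" for i
      using R(2)[OF that] S(2)[OF that] by (simp add: of_nat_poly)
    have "R k - of_nat p * S = 0"
    proof (rule ccontr)
      assume nz: "R k - of_nat p * S \<noteq> 0"
      with dv have "degree e \<le> degree (R k - of_nat p * S)" by (intro dvd_imp_degree_le)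
      from cz[OF this] nz show False unfolding leading_coeff_0_iff by simp
    qed
    then have RS: "R k = of_nat p * S" by simp
    have "coeff (R k) i = 0" for i
    proof (rule ccontr)
      assume nz: "coeff (R k) i \<noteq> 0"
      have "int p dvd coeff (R k) i" unfolding RS by (simp add: of_nat_poly)
      then have "int p \<le> \<bar>coeff (R k) i\<bar>" using nz by (meson dvd_imp_le_int order_trans abs_ge_self)
      also have "\<dots> \<le> int A" by (rule bound[OF k])
      finally show False using p(2) by simp
    qed
    then have "R k = 0" by (intro poly_eqI) simp
    then show ?thesis using evR[of k] pk by simp
  qed
  show ?thesis
  proof (rule that[of A])
    fix p f assume p: "prime p" "p > A" and "ceval f \<zeta> = 0"
    then obtain h where "f = e * h" using e(2) by (auto elim: dvdE)
    then show "ceval f (\<zeta> ^ p) = 0" using main[OF p] by simp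
  qed
qed

text \<open>Modulo \<open>d\<close> the exponent \<open>k\<close> may be changed to one without prime factors up to \<open>A\<close>; such an
  exponent is reached by taking powers with large primes, one after the other.\<close>

lemma conjugate_root_of_unity:
  assumes "\<zeta> ^ d = 1" "d > 0" "coprime k d" and f: "ceval f \<zeta> = 0"
  shows "ceval f (\<zeta> ^ k) = 0"
proof -
  obtain A where A: "\<And>p f. prime p \<Longrightarrow> p > A \<Longrightarrow> ceval f \<zeta> = 0 \<Longrightarrow> ceval f (\<zeta> ^ p) = 0"
    using conjugate_by_large_prime[OF assms(1,2)] by metis
  have large: "ceval f (\<zeta> ^ m) = 0"
    if "m > 0" "\<And>p. prime p \<Longrightarrow> p dvd m \<Longrightarrow> p > A" "ceval f \<zeta> = 0" for m f
    using that
  proof (induction m arbitrary: f rule: less_induct)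
    case (less m)
    show ?case
    proof (cases "m = 1")
      case True
      with less.prems show ?thesis by simp
    next
      case False
      then obtain p where p: "prime p" "p dvd m" using prime_factor_nat by blast
      then obtain m' where m': "m = p * m'" by blast
      have "m' < m" "m' > 0" using m' less.prems(1) prime_gt_1_nat[OF p(1)] by auto
      then have "ceval f (\<zeta> ^ m') = 0" using less.prems m' by (intro less.IH) auto
      then have "ceval (pcompose f (monom 1 m')) \<zeta> = 0" by (simp add: ceval_pcompose)
      from A[OF p(1) less.prems(2)[OF p] this] show ?thesis
        by (simp add: ceval_pcompose m' power_mult)
    qed
  qed
  \<comment> \<open>Every prime up to \<open>A\<close> divides exactly one of the two summands of \<open>m\<close>.\<close>
  define B where "B = {p. prime p \<and> p \<le> A \<and> \<not> p dvd k}"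
  have finB: "finite B" unfolding B_def by (rule finite_subset[of _ "{..A}"]) auto
  define m where "m = k + d * \<Prod>B"
  have "prod id B > 0" using prime_gt_0_nat by (intro prod_pos) (auto simp: B_def)
  then have "m > 0" using assms(2) by (simp add: m_def id_def)
  moreover have "p > A" if p: "prime p" "p dvd m" for p
  proof (rule ccontr)
    assume le: "\<not> p > A"
    show False
    proof (cases "p dvd k")
      case True
      with p(2) have "p dvd d * \<Prod>B" unfolding m_def by (metis dvd_add_right_iff)
      moreover have "\<not> p dvd d" using True assms(3) p(1)
        by (meson coprime_common_divisor not_prime_unit)
      ultimately have "p dvd \<Prod>B" using p(1) by (simp add: prime_dvd_mult_iff)
      then obtain q where "q \<in> B" "p dvd q" using prime_dvd_prod_iff[OF finB p(1), of "\<lambda>x. x"] by auto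
      then show False using True p(1) by (auto simp: B_def dest: primes_dvd_imp_eq)
    next
      case False
      then have "p \<in> B" using le p(1) by (simp add: B_def)
      then have "p dvd d * \<Prod>B" using finB by (simp add: dvd_prod_eqI)
      with p(2) False show False unfolding m_def by (simp add: dvd_add_left_iff)
    qed
  qed
  ultimately have "ceval f (\<zeta> ^ m) = 0" using f by (intro large)
  moreover have "\<zeta> ^ m = \<zeta> ^ k" using assms(1) by (simp add: m_def power_add power_mult)
  ultimately show ?thesis by simp
qed

lemma monic_with_roots_cyclotomic:
  "d > 0 \<Longrightarrow> monic_with_roots (cyclotomic d) (primitive_roots d)"
  by (simp add: monic_with_roots_def finite_primitive_roots map_poly_of_int_cyclotomic)

lemma primitive_roots_power:
  assumes "\<zeta> \<in> primitive_roots d" "\<xi> \<in> primitive_roots d" "d > 0"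
  obtains k where "coprime k d" "\<xi> = \<zeta> ^ k"
proof -
  have inj: "inj_on (\<lambda>k. \<zeta> ^ k) {..<d}"
  proof (rule linorder_inj_onI)
    fix i j assume ij: "i < j" "i \<in> {..<d}" "j \<in> {..<d}"
    show "\<zeta> ^ i \<noteq> \<zeta> ^ j"
    proof
      assume "\<zeta> ^ i = \<zeta> ^ j"
      also have "\<dots> = \<zeta> ^ i * \<zeta> ^ (j - i)" using ij by (simp flip: power_add)
      finally have "\<zeta> ^ (j - i) = 1"
        using assms by (auto simp: primitive_roots_def power_0_left)
      then show False using primitive_root_power_eq_1_iff[OF assms(1,3)] ij
        by (auto dest: dvd_imp_le)
    qed
  qed auto
  have z1: "\<zeta> ^ d = 1" and x1: "\<xi> ^ d = 1" using assms by (auto simp: primitive_roots_def)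
  have "(\<lambda>k. \<zeta> ^ k) ` {..<d} = {z. z ^ d = 1}"
  proof (rule card_subset_eq)
    show "finite {z::complex. z ^ d = 1}" using assms(3) by (intro finite_roots_unity) simp
    show "(\<lambda>k. \<zeta> ^ k) ` {..<d} \<subseteq> {z. z ^ d = 1}"
    proof clarify
      fix k
      have "(\<zeta> ^ k) ^ d = (\<zeta> ^ d) ^ k" by (simp add: mult.commute flip: power_mult)
      then show "(\<zeta> ^ k) ^ d = 1" using z1 by simp
    qed
    show "card ((\<lambda>k. \<zeta> ^ k) ` {..<d}) = card {z::complex. z ^ d = 1}"
      using inj card_roots_unity_eq[OF assms(3)] by (simp add: card_image)
  qed
  with x1 obtain k where k: "\<xi> = \<zeta> ^ k" by blast
  have "coprime k d"
  proof (rule ccontr)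
    define g where "g = gcd k d"
    assume "\<not> coprime k d"
    then have g: "g > 1" using assms(3) unfolding g_def coprime_iff_gcd_eq_1
      by (metis gcd_pos_nat less_one linorder_neqE_nat not_gr0)
    obtain k' d' where kd: "k = g * k'" "d = g * d'" unfolding g_def by (meson dvdE gcd_dvd1 gcd_dvd2)
    have "\<xi> ^ d' = \<zeta> ^ (d * k')" unfolding k kd by (simp add: power_mult[symmetric] mult_ac)
    also have "\<dots> = 1" by (simp add: power_mult z1)
    finally have "d dvd d'" using primitive_root_power_eq_1_iff[OF assms(2,3)] by blast
    then show False using kd(2) g assms(3) by (auto dest!: dvd_imp_le)
  qed
  with k show ?thesis using that by blast
qed

text \<open>Irreducibility of the cyclotomic polynomials, in the form in which it is used: vanishing at one
  primitive root of unity forces vanishing at all of them.\<close>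

theorem cyclotomic_dvd_iff:
  assumes "d > 0" "\<zeta> \<in> primitive_roots d"
  shows "cyclotomic d dvd f \<longleftrightarrow> ceval f \<zeta> = 0"
proof
  assume "cyclotomic d dvd f"
  then show "ceval f \<zeta> = 0"
    using monic_with_roots_dvd_iff[OF monic_with_roots_cyclotomic] assms by blast
next
  assume f: "ceval f \<zeta> = 0"
  have "ceval f \<xi> = 0" if \<xi>: "\<xi> \<in> primitive_roots d" for \<xi>
  proof -
    obtain k where "coprime k d" "\<xi> = \<zeta> ^ k"
      using primitive_roots_power[OF assms(2) \<xi> assms(1)] by blast
    then show ?thesis using conjugate_root_of_unity[of \<zeta> d k f] assms f
      by (auto simp: primitive_roots_def)
  qed
  then show "cyclotomic d dvd f"
    using monic_with_roots_dvd_iff[OF monic_with_roots_cyclotomic] assms(1) by blast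
qed

section \<open>Torsion of the integer polynomials modulo two relations\<close>

text \<open>The torsion subgroup of \<open>\<int>[t] / (\<Phi> g, \<Phi> \<Psi>)\<close> consists of the multiples of \<open>\<Phi>\<close>: a polynomial with a
  nonzero multiple in \<open>(\<Phi>)\<close> vanishes at the roots of \<open>\<Phi>\<close>, and conversely \<open>(g, \<Psi>)\<close> contains a positive
  integer. Division by \<open>\<Phi>\<close> identifies it with \<open>\<int>[t] / (g, \<Psi>)\<close>. If \<open>D = 0\<close>, then
  \<open>\<Psi> = 1\<close> and both sides are \<open>1\<close>.\<close>

lemma card_torsion_cosets:
  fixes D :: "int poly" and r :: nat
  defines "C \<equiv> {d. d dvd r \<and> cyclotomic d dvd D}"
  assumes r: "r > 0"
  obtains g where "D = (\<Prod>d\<in>C. cyclotomic d) * g"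
    and "real (card (cosets_in (ideal2 D (monom 1 r - 1))
        {p. \<exists>n::nat. n > 0 \<and> of_nat n * p \<in> ideal2 D (monom 1 r - 1)})) =
      cmod (\<Prod>\<zeta> | \<zeta> ^ r = 1 \<and> ceval D \<zeta> \<noteq> 0. ceval g \<zeta>)"
proof -
  define \<Phi> where "\<Phi> = (\<Prod>d\<in>C. cyclotomic d)"
  let ?q = "monom 1 r - 1 :: int poly" and ?U = "{\<zeta>::complex. \<zeta> ^ r = 1}"
  have pos: "d > 0" if "d dvd r" for d using that r by (auto intro: Nat.gr0I)
  have finC: "finite C" using r by (intro finite_subset[of C "{d. d dvd r}"]) (auto simp: C_def)
  have disj: "primitive_roots d \<inter> primitive_roots e = {}" if "d dvd r" "e dvd r" "d \<noteq> e" for d e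
    using primitive_root_power_eq_1_iff pos that by (metis disjoint_iff dvd_antisym dvd_refl)
  have q: "monic_with_roots ?q ?U"
  proof -
    have "monic_with_roots (\<Prod>d\<in>{d. d dvd r}. cyclotomic d) (\<Union>d\<in>{d. d dvd r}. primitive_roots d)"
      using r disj by (intro monic_with_roots_prod monic_with_roots_cyclotomic pos) auto
    then have "finite ?U" "map_poly of_int (\<Prod>d\<in>{d. d dvd r}. cyclotomic d) = (\<Prod>\<zeta>\<in>?U. [:-\<zeta>, 1:])"
      unfolding roots_unity_eq_UN_primitive_roots[OF r] by (simp_all add: monic_with_roots_def)
    moreover have "map_poly of_int (\<Prod>d\<in>{d. d dvd r}. cyclotomic d) = (monom 1 r - 1 :: complex poly)"
      using pos by (simp add: of_int_poly_hom.hom_prod map_poly_of_int_cyclotomic prod_primitive_roots[OF r])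
    ultimately show ?thesis
      by (simp add: monic_with_roots_def hom_distribs map_poly_monom)
  qed
  define Z where "Z = {\<zeta>. \<zeta> ^ r = 1 \<and> ceval D \<zeta> = 0}"
  have "Z = (\<Union>d\<in>C. primitive_roots d)"
    using roots_unity_eq_UN_primitive_roots[OF r] cyclotomic_dvd_iff[OF pos, of _ _ D]
    by (fastforce simp: Z_def C_def)
  then have \<Phi>: "monic_with_roots \<Phi> Z"
    unfolding \<Phi>_def using finC disj
    by (simp only:) (intro monic_with_roots_prod monic_with_roots_cyclotomic pos, auto simp: C_def)
  obtain g where g: "D = \<Phi> * g"
    using monic_with_roots_dvd_iff[OF \<Phi>, of D] by (auto simp: Z_def elim: dvdE)
  obtain \<Psi> where \<Psi>: "?q = \<Phi> * \<Psi>"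
    using monic_with_roots_dvd_iff[OF \<Phi>, of ?q] by (auto simp: Z_def elim: dvdE)
  have Zc: "?U - Z = {\<zeta>. \<zeta> ^ r = 1 \<and> ceval D \<zeta> \<noteq> 0}" by (auto simp: Z_def)
  have \<Psi>_roots: "monic_with_roots \<Psi> (?U - Z)"
    using monic_with_roots_cofactor[OF \<Phi>] q unfolding \<Psi> by blast
  have g_nz: "ceval g \<zeta> \<noteq> 0" if "\<zeta> \<in> ?U - Z" for \<zeta> using that by (auto simp: Z_def g)
  have \<Phi>0: "\<Phi> \<noteq> 0" using monic_with_rootsD(2)[OF \<Phi>] by auto
  let ?I = "ideal2 D ?q" and ?J = "ideal2 g \<Psi>"
  have I: "\<Phi> * a \<in> ?I \<longleftrightarrow> a \<in> ?J" for a
  proof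
    assume "\<Phi> * a \<in> ?I"
    then obtain u v where "\<Phi> * a = u * (\<Phi> * g) + v * (\<Phi> * \<Psi>)" unfolding ideal2_def g \<Psi> by blast
    then have "\<Phi> * a = \<Phi> * (u * g + v * \<Psi>)" by (simp add: algebra_simps)
    then show "a \<in> ?J" using \<Phi>0 unfolding ideal2_def by auto
  next
    assume "a \<in> ?J"
    then obtain u v where "a = u * g + v * \<Psi>" unfolding ideal2_def by blast
    then have "\<Phi> * a = u * D + v * ?q" unfolding g \<Psi> by (simp add: algebra_simps)
    then show "\<Phi> * a \<in> ?I" unfolding ideal2_def by blast
  qed
  have "\<Psi> \<noteq> 0" using monic_with_rootsD(2)[OF \<Psi>_roots] by auto
  then obtain N where N: "N > 0" "[:N:] \<in> ?J"
    using ideal2_contains_const[of \<Psi> g] g_nz monic_with_rootsD(4)[OF \<Psi>_roots] by blast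
  have T: "{p. \<exists>n::nat. n > 0 \<and> of_nat n * p \<in> ?I} = range ((*) \<Phi>)"
  proof (intro equalityI subsetI)
    fix p assume "p \<in> {p. \<exists>n::nat. n > 0 \<and> of_nat n * p \<in> ?I}"
    then obtain n :: nat and u v where n: "n > 0" "of_nat n * p = u * D + v * ?q"
      unfolding ideal2_def by blast
    have "ceval p \<zeta> = 0" if "\<zeta> \<in> Z" for \<zeta>
    proof -
      have "of_nat n * ceval p \<zeta> = ceval (of_nat n * p) \<zeta>" by simp
      also have "\<dots> = 0" unfolding n(2) using that by (simp add: Z_def)
      finally show ?thesis using n(1) by simp
    qed
    then have "\<Phi> dvd p" using monic_with_roots_dvd_iff[OF \<Phi>] by blast
    then show "p \<in> range ((*) \<Phi>)" by (auto elim: dvdE)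
  next
    fix p assume "p \<in> range ((*) \<Phi>)"
    then obtain a where a: "p = \<Phi> * a" by blast
    have "a * [:N:] \<in> ?J" by (intro ideal2_mult N)
    moreover have "of_nat (nat N) * a = a * [:N:]" using N(1) by (simp add: of_nat_poly)
    ultimately have "of_nat (nat N) * p \<in> ?I" using I[of "of_nat (nat N) * a"] by (simp add: a mult.left_commute)
    then show "p \<in> {p. \<exists>n::nat. n > 0 \<and> of_nat n * p \<in> ?I}" using N(1) by (intro CollectI exI[of _ "nat N"]) simp
  qed
  have "card (cosets_in ?I (range ((*) \<Phi>))) = card (cosets_in ?J UNIV)"
    unfolding cosets_in_def image_image
  proof (rule card_image_eq_card_image)
    have coset_eq: "{q. q - a \<in> ideal2 c d} = {q. q - b \<in> ideal2 c d} \<longleftrightarrow> a - b \<in> ideal2 c d"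
      for a b c d :: "int poly"
    proof
      assume "{q. q - a \<in> ideal2 c d} = {q. q - b \<in> ideal2 c d}"
      moreover have "a \<in> {q. q - a \<in> ideal2 c d}" by (simp add: ideal2_0)
      ultimately show "a - b \<in> ideal2 c d" by blast
    next
      assume ab: "a - b \<in> ideal2 c d"
      have "q - a \<in> ideal2 c d \<longleftrightarrow> q - b \<in> ideal2 c d" for q
        using ideal2_add[OF _ ab, of "q - a"] ideal2_diff[OF _ ab, of "q - b"] by auto
      then show "{q. q - a \<in> ideal2 c d} = {q. q - b \<in> ideal2 c d}" by simp
    qed
    fix a b
    show "{q. q - \<Phi> * a \<in> ?I} = {q. q - \<Phi> * b \<in> ?I} \<longleftrightarrow> {q. q - a \<in> ?J} = {q. q - b \<in> ?J}"
      unfolding coset_eq using I[of "a - b"] by (simp add: right_diff_distrib)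
  qed
  then have "real (card (cosets_in ?I {p. \<exists>n::nat. n > 0 \<and> of_nat n * p \<in> ?I}))
      = cmod (\<Prod>\<zeta>\<in>?U - Z. ceval g \<zeta>)"
    unfolding T using card_cosets_ideal2[OF \<Psi>_roots g_nz] by simp
  with g show ?thesis unfolding Zc \<Phi>_def by (intro that[of g])
qed

section \<open>Laurent polynomials as shifted polynomials\<close>

abbreviation (input) lmonom :: "int \<Rightarrow> laurent" where
  "lmonom k \<equiv> Poly_Mapping.single k 1"

lemma lmonom_mult: "lmonom j * lmonom k = lmonom (j + k)"
  by (simp add: mult_single)

lemma laurent_t_power: "laurent_t ^ n = lmonom (int n)"
  by (induction n) (simp_all add: laurent_t_def mult_single)

lemma lookup_laurent_of_poly: "Poly_Mapping.lookup (laurent_of_poly p) (int i) = coeff p i"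
proof -
  have "Poly_Mapping.lookup (laurent_of_poly p) (int i) = (\<Sum>j\<le>degree p. if j = i then coeff p j else 0)"
    unfolding laurent_of_poly_def lookup_sum by (intro sum.cong) (auto simp: lookup_single when_def)
  then show ?thesis by (auto simp: coeff_eq_0 not_le)
qed

lemma laurent_of_poly_inject: "laurent_of_poly p = laurent_of_poly q \<Longrightarrow> p = q"
  by (metis lookup_laurent_of_poly poly_eqI)

text \<open>Presenting the embedding as evaluation at \<open>t\<close> makes it visibly a ring homomorphism.\<close>

lemma laurent_of_poly_eq_poly: "laurent_of_poly p = poly (map_poly of_int p) laurent_t"
proof -
  have "Poly_Mapping.single (int i) c = of_int c * laurent_t ^ i" for i and c :: int
    unfolding laurent_t_power by (simp add: mult_single flip: single_of_int)
  then show ?thesis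
    unfolding laurent_of_poly_def poly_altdef by (simp add: of_int_hom.degree_map_poly_hom)
qed

lemma laurent_of_poly_hom:
  "laurent_of_poly 0 = 0" "laurent_of_poly 1 = 1"
  "laurent_of_poly (p + q) = laurent_of_poly p + laurent_of_poly q"
  "laurent_of_poly (p - q) = laurent_of_poly p - laurent_of_poly q"
  "laurent_of_poly (p * q) = laurent_of_poly p * laurent_of_poly q"
  "laurent_of_poly (monom 1 n) = lmonom (int n)"
  by (simp_all add: laurent_of_poly_eq_poly hom_distribs map_poly_monom poly_monom laurent_t_power
      of_int_poly_hom.hom_mult)

lemma laurent_of_poly_prod: "laurent_of_poly (prod f A) = (\<Prod>a\<in>A. laurent_of_poly (f a))"
  by (induction A rule: infinite_finite_induct) (simp_all add: laurent_of_poly_hom)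

lemma laurent_of_poly_dvd: "p dvd q \<Longrightarrow> laurent_of_poly p dvd laurent_of_poly q"
  by (auto simp: dvd_def laurent_of_poly_hom)

lemma laurent_of_poly_sum: "laurent_of_poly (sum f A) = (\<Sum>a\<in>A. laurent_of_poly (f a))"
  by (induction A rule: infinite_finite_induct) (simp_all add: laurent_of_poly_hom)

lemma laurent_of_poly_monom: "laurent_of_poly (monom c n) = Poly_Mapping.single (int n) c"
  by (cases "c = 0") (simp_all add: laurent_of_poly_def degree_monom_eq sum.delta' if_distrib cong: if_cong)

lemma laurent_eq_shifted_poly:
  obtains k q where "a = lmonom (- int k) * laurent_of_poly q"
proof -
  define k where "k = (\<Sum>j\<in>Poly_Mapping.keys a. nat \<bar>j\<bar>)"
  have k: "j + int k \<ge> 0" if "j \<in> Poly_Mapping.keys a" for j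
  proof -
    have "nat \<bar>j\<bar> \<le> k" unfolding k_def using that by (intro member_le_sum) auto
    then show ?thesis by linarith
  qed
  define q where "q = (\<Sum>j\<in>Poly_Mapping.keys a. monom (Poly_Mapping.lookup a j) (nat (j + int k)))"
  have "lmonom (- int k) * laurent_of_poly q
      = (\<Sum>j\<in>Poly_Mapping.keys a. Poly_Mapping.single j (Poly_Mapping.lookup a j))"
    using k by (simp add: q_def laurent_of_poly_sum laurent_of_poly_monom sum_distrib_left mult_single)
  also have "\<dots> = a"
    by (intro poly_mapping_eqI) (simp add: lookup_sum lookup_single when_def in_keys_iff)
  finally show ?thesis by (intro that[of k q]) simp
qed

lemma laurent_eval_superset:
  assumes "finite K" "Poly_Mapping.keys a \<subseteq> K"
  shows "laurent_eval a z = (\<Sum>k\<in>K. of_int (Poly_Mapping.lookup a k) * z powi k)"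
  unfolding laurent_eval_def using assms
  by (intro sum.mono_neutral_left) (auto simp: in_keys_iff)

lemma laurent_eval_add: "laurent_eval (a + b) z = laurent_eval a z + laurent_eval b z"
proof -
  let ?K = "Poly_Mapping.keys a \<union> Poly_Mapping.keys b"
  have "Poly_Mapping.keys (a + b) \<subseteq> ?K" by (rule Poly_Mapping.keys_add)
  then show ?thesis
    by (simp add: laurent_eval_superset[of ?K] lookup_add distrib_right sum.distrib)
qed

lemma laurent_eval_sum: "laurent_eval (sum f A) z = (\<Sum>a\<in>A. laurent_eval (f a) z)"
  by (induction A rule: infinite_finite_induct) (simp_all add: laurent_eval_add, simp_all add: laurent_eval_def)

lemma laurent_eval_single: "laurent_eval (Poly_Mapping.single k c) z = of_int c * z powi k"
  by (simp add: laurent_eval_def)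

lemma laurent_eval_shifted_poly:
  assumes "z \<noteq> 0"
  shows "laurent_eval (lmonom j * laurent_of_poly p) z = z powi j * ceval p z"
proof -
  have "lmonom j * laurent_of_poly p = (\<Sum>i\<le>degree p. Poly_Mapping.single (j + int i) (coeff p i))"
    by (simp add: laurent_of_poly_def sum_distrib_left mult_single)
  then have "laurent_eval (lmonom j * laurent_of_poly p) z
      = (\<Sum>i\<le>degree p. z powi j * (of_int (coeff p i) * z ^ i))"
    using assms by (simp add: laurent_eval_sum laurent_eval_single power_int_add mult_ac)
  also have "\<dots> = z powi j * ceval p z"
    by (subst ceval_eq_sum[of "Suc (degree p)"]) (auto simp: coeff_eq_0 sum_distrib_left lessThan_Suc_atMost)
  finally show ?thesis .
qed

lemma laurent_eval_mult:
  assumes "z \<noteq> 0"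
  shows "laurent_eval (a * b) z = laurent_eval a z * laurent_eval b z"
proof -
  obtain k p where a: "a = lmonom (- int k) * laurent_of_poly p" by (rule laurent_eq_shifted_poly)
  obtain l q where b: "b = lmonom (- int l) * laurent_of_poly q" by (rule laurent_eq_shifted_poly)
  have "a * b = (lmonom (- int k) * lmonom (- int l)) * laurent_of_poly (p * q)"
    unfolding a b laurent_of_poly_hom by (simp only: mult_ac)
  then have "a * b = lmonom (- int k + - int l) * laurent_of_poly (p * q)"
    unfolding lmonom_mult .
  then have "laurent_eval (a * b) z = z powi (- int k + - int l) * ceval (p * q) z"
    by (simp only: laurent_eval_shifted_poly[OF assms])
  also have "\<dots> = (z powi (- int k) * ceval p z) * (z powi (- int l) * ceval q z)"
    using assms by (subst power_int_add) auto
  finally show ?thesis unfolding a b laurent_eval_shifted_poly[OF assms] .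
qed

lemma laurent_eval_laurent_of_poly: "z \<noteq> 0 \<Longrightarrow> laurent_eval (laurent_of_poly p) z = ceval p z"
  using laurent_eval_shifted_poly[of z 0 p] by simp

lemma minus_1_dvd_power_minus_1: "(x :: 'a::comm_ring_1) ^ r - 1 dvd x ^ (r * m) - 1"
  by (simp add: power_mult power_diff_1_eq)

text \<open>Clearing denominators in a relation multiplies \<open>q\<close> by a power of \<open>t\<close>. That power may be taken
  divisible by \<open>r\<close>, and is then congruent to \<open>1\<close> modulo \<open>t ^ r - 1\<close>.\<close>

lemma laurent_of_poly_mem_ideal2_iff:
  assumes "r > 0"
  shows "laurent_of_poly q \<in> ideal2 (lmonom (- int k) * laurent_of_poly D) (laurent_t ^ r - 1)
     \<longleftrightarrow> q \<in> ideal2 D (monom 1 r - 1)"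
proof
  assume "q \<in> ideal2 D (monom 1 r - 1)"
  then obtain u v where "q = u * D + v * (monom 1 r - 1)" unfolding ideal2_def by blast
  then have "laurent_of_poly q = (laurent_of_poly u * (lmonom (int k) * lmonom (- int k))) * laurent_of_poly D
      + laurent_of_poly v * (laurent_t ^ r - 1)"
    by (simp add: laurent_of_poly_hom laurent_t_power lmonom_mult)
  also have "\<dots> = (laurent_of_poly u * lmonom (int k)) * (lmonom (- int k) * laurent_of_poly D)
      + laurent_of_poly v * (laurent_t ^ r - 1)"
    by (simp only: mult_ac)
  finally show "laurent_of_poly q \<in> ideal2 (lmonom (- int k) * laurent_of_poly D) (laurent_t ^ r - 1)"
    unfolding ideal2_def by blast
next
  assume "laurent_of_poly q \<in> ideal2 (lmonom (- int k) * laurent_of_poly D) (laurent_t ^ r - 1)"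
  then obtain u v where uv: "laurent_of_poly q
      = u * (lmonom (- int k) * laurent_of_poly D) + v * (laurent_t ^ r - 1)"
    unfolding ideal2_def by blast
  obtain a u' where u: "u = lmonom (- int a) * laurent_of_poly u'" by (rule laurent_eq_shifted_poly)
  obtain b v' where v: "v = lmonom (- int b) * laurent_of_poly v'" by (rule laurent_eq_shifted_poly)
  define n where "n = r * (a + k + b)"
  have n: "n \<ge> a + k + b" using assms by (simp add: n_def)
  have "laurent_of_poly (monom 1 n * q) = lmonom (int n) * laurent_of_poly q"
    by (simp add: laurent_of_poly_hom)
  also have "\<dots> = (lmonom (int n) * lmonom (- int a) * lmonom (- int k)) * laurent_of_poly u' * laurent_of_poly D
     + (lmonom (int n) * lmonom (- int b)) * laurent_of_poly v' * (laurent_t ^ r - 1)"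
    unfolding uv u v by (simp only: distrib_left mult_ac)
  also have "\<dots> = laurent_of_poly (monom 1 (n - a - k) * u' * D + monom 1 (n - b) * v' * (monom 1 r - 1))"
    using n by (simp add: laurent_of_poly_hom lmonom_mult laurent_t_power of_nat_diff diff_diff_eq)
  finally have "monom 1 n * q = monom 1 (n - a - k) * u' * D + monom 1 (n - b) * v' * (monom 1 r - 1)"
    by (rule laurent_of_poly_inject)
  then have "monom 1 n * q \<in> ideal2 D (monom 1 r - 1)" unfolding ideal2_def by blast
  moreover have "monom 1 n - 1 \<in> ideal2 D (monom 1 r - 1)"
  proof -
    have "monom 1 r - 1 dvd (monom 1 n - 1 :: int poly)"
      using minus_1_dvd_power_minus_1[of "monom 1 1 :: int poly" r "a + k + b"]
      by (simp add: n_def monom_power)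
    then obtain c where "monom 1 n - 1 = c * (monom 1 r - 1 :: int poly)" by (metis dvdE mult.commute)
    then show ?thesis by (simp only:) (intro ideal2_mult ideal2_gens)
  qed
  ultimately have "monom 1 n * q - q * (monom 1 n - 1) \<in> ideal2 D (monom 1 r - 1)"
    by (rule ideal2_diff[OF _ ideal2_mult])
  then show "q \<in> ideal2 D (monom 1 r - 1)" by (simp add: algebra_simps)
qed

text \<open>Multiplying by a power of \<open>t ^ r\<close> clears the denominator without changing the residue class.\<close>

lemma laurent_reduces_to_poly:
  assumes "r > 0"
  shows "\<exists>q. a - laurent_of_poly q \<in> ideal2 \<Delta> (laurent_t ^ r - 1)"
proof -
  obtain k q where a: "a = lmonom (- int k) * laurent_of_poly q" by (rule laurent_eq_shifted_poly)
  define n where "n = r * k"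
  have n: "n \<ge> k" using assms by (simp add: n_def)
  have "laurent_of_poly (monom 1 (n - k) * q) = lmonom (- int k) * lmonom (int n) * laurent_of_poly q"
    using n by (simp add: laurent_of_poly_hom lmonom_mult of_nat_diff)
  then have "a - laurent_of_poly (monom 1 (n - k) * q) = - a * (laurent_t ^ n - 1)"
    unfolding a laurent_t_power by (simp add: algebra_simps)
  moreover obtain c where "laurent_t ^ n - 1 = c * (laurent_t ^ r - 1)"
    using minus_1_dvd_power_minus_1[of laurent_t r k] by (metis n_def dvdE mult.commute)
  ultimately have "a - laurent_of_poly (monom 1 (n - k) * q) \<in> ideal2 \<Delta> (laurent_t ^ r - 1)"
    by (simp only:) (intro ideal2_mult ideal2_gens)
  then show ?thesis by blast
qed

section \<open>Torsion numbers of cyclic modules\<close>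

text \<open>The map \<open>\<phi>\<close> induces an isomorphism from the quotient by \<open>I\<close> onto \<open>M / W\<close>; it has to be onto only
  modulo \<open>W\<close>.\<close>

lemma card_torsion_quotient_module:
  fixes M :: "('a, 'b, 'm) module_scheme" and \<phi> :: "'c::comm_ring_1 \<Rightarrow> 'b"
  assumes M: "abelian_group M" and W: "additive_subgroup W M"
    and \<phi>_in: "\<And>p. \<phi> p \<in> carrier M"
    and \<phi>_add: "\<And>p q. \<phi> (p + q) = \<phi> p \<oplus>\<^bsub>M\<^esub> \<phi> q"
    and onto: "\<And>m. m \<in> carrier M \<Longrightarrow> \<exists>p. \<exists>w\<in>W. m = w \<oplus>\<^bsub>M\<^esub> \<phi> p"
    and I: "\<And>p. \<phi> p \<in> W \<longleftrightarrow> p \<in> I"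
  shows "card (torsion_elements (quotient_module M W)) =
    card (cosets_in I {p. \<exists>n::nat. n > 0 \<and> of_nat n * p \<in> I})"
proof -
  let ?H = "add_monoid M" and ?T = "{p. \<exists>n::nat. n > 0 \<and> of_nat n * p \<in> I}"
  interpret H: comm_group ?H by (rule abelian_group.a_comm_group[OF M])
  interpret M: abelian_group M by fact
  have sub: "subgroup W ?H" using W by (simp add: additive_subgroup_def)
  interpret W: normal W ?H by (rule H.subgroup_imp_normal[OF sub])
  let ?Q = "?H Mod W"
  have Q: "[n] \<cdot>\<^bsub>quotient_module M W\<^esub> C = C [^]\<^bsub>?Q\<^esub> n" for n :: nat and C
    by (simp add: add_pow_def nat_pow_def quotient_module_def FactGroup_def set_add_def)
  have carQ: "carrier (quotient_module M W) = carrier ?Q" "\<zero>\<^bsub>quotient_module M W\<^esub> = \<one>\<^bsub>?Q\<^esub>"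
    by (simp_all add: quotient_module_def FactGroup_def A_RCOSETS_def)
  interpret Q: group ?Q by (rule W.factorgroup_is_group)
  let ?h = "\<lambda>p. W #>\<^bsub>?H\<^esub> \<phi> p"
  have \<phi>_0: "\<phi> 0 = \<zero>\<^bsub>M\<^esub>" using \<phi>_add[of 0 0] \<phi>_in[of 0] H.l_cancel_one[of "\<phi> 0" "\<phi> 0"] by simp
  have \<phi>_neg: "\<phi> (- p) = \<ominus>\<^bsub>M\<^esub> \<phi> p" for p
    using \<phi>_add[of "- p" p] \<phi>_0 \<phi>_in by (intro M.minus_equality[symmetric]) simp_all
  have h_in: "?h p \<in> carrier ?Q" for p
    using \<phi>_in[of p] by (auto simp: FactGroup_def RCOSETS_def)
  have h_add: "?h (p + q) = ?h p \<otimes>\<^bsub>?Q\<^esub> ?h q" for p q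
    using \<phi>_in[of p] \<phi>_in[of q] by (simp add: \<phi>_add W.rcos_sum)
  have h_one: "?h p = \<one>\<^bsub>?Q\<^esub> \<longleftrightarrow> p \<in> I" for p
    using I[of p] \<phi>_in[of p] H.coset_join1[of W "\<phi> p"] H.coset_join2[of "\<phi> p" W] sub subgroup.subset[OF sub]
    by auto
  have h_pow: "?h p [^]\<^bsub>?Q\<^esub> n = ?h (of_nat n * p)" for p and n :: nat
  proof (induction n)
    case 0
    have "0 \<in> I" using I[of 0] \<phi>_0 subgroup.one_closed[OF sub] by simp
    then show ?case using h_one[of 0] by simp
  next
    case (Suc n)
    have "of_nat (Suc n) * p = of_nat n * p + p" by (simp add: algebra_simps)
    then show ?case using Suc h_add by simp
  qed
  have h_eq: "?h p = ?h q \<longleftrightarrow> p - q \<in> I" for p q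
  proof -
    have "?h p = ?h (p - q) \<otimes>\<^bsub>?Q\<^esub> ?h q" using h_add[of "p - q" q] by simp
    then have "?h p = ?h q \<longleftrightarrow> ?h (p - q) = \<one>\<^bsub>?Q\<^esub>"
      using Q.r_cancel_one[OF h_in[of q] h_in[of "p - q"]] by metis
    then show ?thesis using h_one by simp
  qed
  have I_0: "0 \<in> I" using h_eq[of 0 0] by simp
  have "torsion_elements (quotient_module M W) = ?h ` ?T"
  proof -
    have "torsion_elements (quotient_module M W) = {C \<in> carrier ?Q. \<exists>n::nat. n > 0 \<and> C [^]\<^bsub>?Q\<^esub> n = \<one>\<^bsub>?Q\<^esub>}"
      unfolding torsion_elements_def carQ Q ..
    also have "carrier ?Q = range ?h"
    proof (intro equalityI subsetI)
      fix C assume "C \<in> carrier ?Q"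
      then obtain m where m: "m \<in> carrier M" "C = W #>\<^bsub>?H\<^esub> m"
        by (auto simp: FactGroup_def RCOSETS_def)
      obtain p w where "w \<in> W" "m = w \<oplus>\<^bsub>M\<^esub> \<phi> p" using onto[OF m(1)] by blast
      then have "m \<in> ?h p" by (auto simp: r_coset_def)
      then have "?h p = W #>\<^bsub>?H\<^esub> m" using \<phi>_in[of p] by (intro H.repr_independence sub) simp_all
      then show "C \<in> range ?h" using m(2) by blast
    qed (use h_in in auto)
    also have "{C \<in> range ?h. \<exists>n::nat. n > 0 \<and> C [^]\<^bsub>?Q\<^esub> n = \<one>\<^bsub>?Q\<^esub>} =
        ?h ` {p. \<exists>n::nat. n > 0 \<and> ?h p [^]\<^bsub>?Q\<^esub> n = \<one>\<^bsub>?Q\<^esub>}"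
      by blast
    finally show ?thesis unfolding h_pow h_one .
  qed
  then have "card (torsion_elements (quotient_module M W)) = card (?h ` ?T)" by simp
  also have "\<dots> = card (cosets_in I ?T)"
    unfolding cosets_in_def
  proof (rule card_image_eq_card_image)
    fix p q
    have "{x. x - p \<in> I} = {x. x - q \<in> I} \<longleftrightarrow> p - q \<in> I"
    proof
      assume "{x. x - p \<in> I} = {x. x - q \<in> I}"
      then show "p - q \<in> I" using I_0 by (metis cancel_comm_monoid_add_class.diff_cancel mem_Collect_eq)
    next
      assume "p - q \<in> I"
      then have "?h p = ?h q" by (simp add: h_eq)
      then have "x - p \<in> I \<longleftrightarrow> x - q \<in> I" for x using h_eq[of x p] h_eq[of x q] by simp
      then show "{x. x - p \<in> I} = {x. x - q \<in> I}" by simp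
    qed
    then show "?h p = ?h q \<longleftrightarrow> {x. x - p \<in> I} = {x. x - q \<in> I}" using h_eq by simp
  qed
  finally show ?thesis .
qed

text \<open>Pulling the residue classes of Laurent polynomials modulo \<open>\<Delta>\<close> back along the isomorphism gives a
  map \<open>\<psi>\<close> from Laurent polynomials onto \<open>M\<close>, under which \<open>(t ^ r - 1) M\<close> corresponds to the ideal
  generated by \<open>\<Delta>\<close> and \<open>t ^ r - 1\<close>. Restricted to polynomials, \<open>\<psi>\<close> is still onto modulo this
  submodule.\<close>

lemma torsion_number_cyclic_module:
  fixes M :: "(laurent, 'b, 'm) module_scheme"
  assumes M: "abelian_group M"
    and smult: "\<And>p m. m \<in> carrier M \<Longrightarrow> p \<odot>\<^bsub>M\<^esub> m \<in> carrier M"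
    and iso: "module_iso (class_ring :: laurent ring) M
      (quotient_module regular_module (PIdl\<^bsub>class_ring\<^esub> \<Delta>))"
    and \<Delta>: "\<Delta> = lmonom (- int k) * laurent_of_poly D" and r: "r > 0"
  shows "torsion_number M r = card (cosets_in (ideal2 D (monom 1 r - 1))
    {p. \<exists>n::nat. n > 0 \<and> of_nat n * p \<in> ideal2 D (monom 1 r - 1)})"
proof -
  let ?P = "PIdl\<^bsub>class_ring\<^esub> \<Delta>"
  let ?N = "quotient_module (regular_module :: (laurent, laurent) module) ?P"
  let ?s = "laurent_t ^ r - 1"
  interpret M: abelian_group M by fact
  define cls where "cls a = {q. \<Delta> dvd q - a}" for a
  have coset: "?P +>\<^bsub>regular_module\<^esub> a = cls a" for a
    by (auto simp: cgenideal_def a_r_coset_def r_coset_def regular_module_def cls_def dvd_def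
        algebra_simps)
  have "carrier ?N = (\<Union>a\<in>carrier regular_module. {?P +>\<^bsub>regular_module\<^esub> a})"
    by (simp add: quotient_module_def A_RCOSETS_def RCOSETS_def a_r_coset_def)
  then have carN: "carrier ?N = range cls"
    unfolding coset by (auto simp: regular_module_def)
  have cls_eq: "cls a = cls b \<longleftrightarrow> \<Delta> dvd a - b" for a b
  proof
    assume "cls a = cls b"
    moreover have "a \<in> cls a" by (simp add: cls_def)
    ultimately show "\<Delta> dvd a - b" by (auto simp: cls_def)
  next
    assume ab: "\<Delta> dvd a - b"
    have "\<Delta> dvd q - a \<longleftrightarrow> \<Delta> dvd q - b" for q
      using dvd_add[OF _ ab, of "q - a"] dvd_diff[OF _ ab, of "q - b"] by auto
    then show "cls a = cls b" by (simp add: cls_def)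
  qed
  have addN: "cls a \<oplus>\<^bsub>?N\<^esub> cls b = cls (a + b)" for a b
  proof -
    have "cls a \<oplus>\<^bsub>?N\<^esub> cls b = {u + v | u v. u \<in> cls a \<and> v \<in> cls b}"
      by (auto simp: quotient_module_def regular_module_def set_add_def set_mult_def)
    also have "\<dots> = cls (a + b)"
    proof (intro equalityI subsetI)
      fix q assume "q \<in> {u + v | u v. u \<in> cls a \<and> v \<in> cls b}"
      then obtain u v where uv: "q = u + v" "\<Delta> dvd u - a" "\<Delta> dvd v - b" by (auto simp: cls_def)
      have "q - (a + b) = (u - a) + (v - b)" by (simp add: uv(1))
      then show "q \<in> cls (a + b)" using dvd_add[OF uv(2,3)] by (simp only: cls_def mem_Collect_eq)
    next
      fix q assume "q \<in> cls (a + b)"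
      then have "q - b \<in> cls a" by (simp add: cls_def algebra_simps)
      moreover have "b \<in> cls b" "q = (q - b) + b" by (simp_all add: cls_def)
      ultimately show "q \<in> {u + v | u v. u \<in> cls a \<and> v \<in> cls b}" by blast
    qed
    finally show ?thesis .
  qed
  have smultN: "c \<odot>\<^bsub>?N\<^esub> cls b = cls (c * b)" for c b
  proof -
    have "c \<odot>\<^bsub>?N\<^esub> cls b = (\<Union>v\<in>cls b. cls (c * v))"
      unfolding coset[symmetric] by (simp add: quotient_module_def regular_module_def)
    moreover have "cls (c * v) = cls (c * b)" if "v \<in> cls b" for v
      using that unfolding cls_eq right_diff_distrib[symmetric] by (simp add: cls_def)
    moreover have "b \<in> cls b" by (simp add: cls_def)
    ultimately show ?thesis by blast
  qed
  obtain f where f: "f \<in> LinearCombinations.module_hom class_ring M ?N"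
    and bij: "bij_betw f (carrier M) (carrier ?N)"
    using iso by (auto simp: module_iso_def)
  have f_add: "f (m \<oplus>\<^bsub>M\<^esub> m') = f m \<oplus>\<^bsub>?N\<^esub> f m'" if "m \<in> carrier M" "m' \<in> carrier M" for m m'
    using f that by (simp add: LinearCombinations.module_hom_def)
  have f_smult: "f (c \<odot>\<^bsub>M\<^esub> m) = c \<odot>\<^bsub>?N\<^esub> f m" if "m \<in> carrier M" for c m
    using f that by (simp add: LinearCombinations.module_hom_def)
  define \<psi> where "\<psi> a = inv_into (carrier M) f (cls a)" for a
  have cls_im: "cls a \<in> f ` carrier M" for a
    using bij carN by (simp add: bij_betw_def)
  have \<psi>_in: "\<psi> a \<in> carrier M" and f_\<psi>: "f (\<psi> a) = cls a" for a
    unfolding \<psi>_def by (rule inv_into_into[OF cls_im], rule f_inv_into_f[OF cls_im])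
  have eq_\<psi>: "m = \<psi> a" if "m \<in> carrier M" "f m = cls a" for m a
    using bij_betw_imp_inj_on[OF bij] by (rule inj_onD) (simp_all add: \<psi>_in f_\<psi> that)
  have \<psi>_eq: "\<psi> a = \<psi> b \<longleftrightarrow> \<Delta> dvd a - b" for a b
    using eq_\<psi>[OF \<psi>_in] f_\<psi> cls_eq by metis
  have \<psi>_add: "\<psi> (a + b) = \<psi> a \<oplus>\<^bsub>M\<^esub> \<psi> b" for a b
    by (rule eq_\<psi>[symmetric]) (simp_all add: \<psi>_in f_add f_\<psi> addN)
  have \<psi>_smult: "\<psi> (c * b) = c \<odot>\<^bsub>M\<^esub> \<psi> b" for c b
    by (rule eq_\<psi>[symmetric]) (simp_all add: \<psi>_in smult f_smult f_\<psi> smultN)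
  have \<psi>_surj: "\<exists>a. m = \<psi> a" if "m \<in> carrier M" for m
  proof -
    have "f m \<in> range cls" using bij_betwE[OF bij] that unfolding carN by blast
    then show ?thesis using eq_\<psi>[OF that] by blast
  qed
  define W where "W = {?s \<odot>\<^bsub>M\<^esub> m | m. m \<in> carrier M}"
  have W_eq: "W = range (\<lambda>a. \<psi> (?s * a))"
  proof (intro equalityI subsetI)
    fix w assume "w \<in> W"
    then obtain m where "m \<in> carrier M" "w = ?s \<odot>\<^bsub>M\<^esub> m" unfolding W_def by blast
    then show "w \<in> range (\<lambda>a. \<psi> (?s * a))" using \<psi>_surj[of m] \<psi>_smult by auto
  next
    fix w assume "w \<in> range (\<lambda>a. \<psi> (?s * a))"
    then show "w \<in> W" using \<psi>_in unfolding W_def \<psi>_smult by blast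
  qed
  have \<psi>_W: "\<psi> p \<in> W \<longleftrightarrow> p \<in> ideal2 \<Delta> ?s" for p
  proof
    assume "\<psi> p \<in> W"
    then obtain a where "\<Delta> dvd p - ?s * a" unfolding W_eq using \<psi>_eq by blast
    then obtain u where "p - ?s * a = \<Delta> * u" by blast
    then have "p = u * \<Delta> + a * ?s" by (simp add: algebra_simps)
    then show "p \<in> ideal2 \<Delta> ?s" unfolding ideal2_def by blast
  next
    assume "p \<in> ideal2 \<Delta> ?s"
    then obtain u v where "p = u * \<Delta> + v * ?s" unfolding ideal2_def by blast
    then have "p - ?s * v = \<Delta> * u" by (simp add: algebra_simps)
    then have "\<psi> p = \<psi> (?s * v)" using \<psi>_eq by simp
    then show "\<psi> p \<in> W" unfolding W_eq by blast
  qed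
  have W_sub: "additive_subgroup W M"
  proof (rule additive_subgroup.intro, rule group.subgroupI[OF comm_group.axioms(2)[OF M.a_comm_group]])
    show "W \<subseteq> carrier (add_monoid M)" unfolding W_eq using \<psi>_in by auto
    show "W \<noteq> {}" unfolding W_eq by blast
    fix w assume w: "w \<in> W"
    then obtain a where a: "w = \<psi> (?s * a)" unfolding W_eq by blast
    have "\<psi> 0 = \<zero>\<^bsub>M\<^esub>"
      using \<psi>_add[of 0 0] \<psi>_in[of 0] group.l_cancel_one[OF comm_group.axioms(2)[OF M.a_comm_group], of "\<psi> 0" "\<psi> 0"]
      by simp
    then have "\<ominus>\<^bsub>M\<^esub> w = \<psi> (?s * (- a))"
      using \<psi>_add[of "?s * (- a)" "?s * a"] \<psi>_in unfolding a by (intro M.minus_equality) simp_all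
    then show "inv\<^bsub>add_monoid M\<^esub> w \<in> W" unfolding W_eq a_inv_def by blast
    fix w' assume "w' \<in> W"
    then obtain b where b: "w' = \<psi> (?s * b)" unfolding W_eq by blast
    have "w \<oplus>\<^bsub>M\<^esub> w' = \<psi> (?s * (a + b))" by (simp add: a b \<psi>_add distrib_left)
    then show "w \<otimes>\<^bsub>add_monoid M\<^esub> w' \<in> W" unfolding W_eq by auto
  qed
  have "torsion_number M r = card (torsion_elements (quotient_module M W))"
    by (simp add: torsion_number_def reduced_module_def W_def)
  also have "\<dots> = card (cosets_in (ideal2 D (monom 1 r - 1))
    {p. \<exists>n::nat. n > 0 \<and> of_nat n * p \<in> ideal2 D (monom 1 r - 1)})"
  proof (rule card_torsion_quotient_module[OF M W_sub])
    show "\<psi> (laurent_of_poly p) \<in> carrier M" for p by (rule \<psi>_in)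
    show "\<psi> (laurent_of_poly (p + q)) = \<psi> (laurent_of_poly p) \<oplus>\<^bsub>M\<^esub> \<psi> (laurent_of_poly q)" for p q
      by (simp add: laurent_of_poly_hom \<psi>_add)
    show "\<exists>p. \<exists>w\<in>W. m = w \<oplus>\<^bsub>M\<^esub> \<psi> (laurent_of_poly p)" if m: "m \<in> carrier M" for m
    proof -
      obtain a where a: "m = \<psi> a" using \<psi>_surj[OF m] by blast
      obtain q where q: "a - laurent_of_poly q \<in> ideal2 \<Delta> ?s"
        using laurent_reduces_to_poly[OF r] by blast
      have "m = \<psi> (a - laurent_of_poly q) \<oplus>\<^bsub>M\<^esub> \<psi> (laurent_of_poly q)"
        by (simp add: a flip: \<psi>_add)
      then show ?thesis using q \<psi>_W by blast
    qed
    show "\<psi> (laurent_of_poly p) \<in> W \<longleftrightarrow> p \<in> ideal2 D (monom 1 r - 1)" for p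
      unfolding \<psi>_W unfolding \<Delta> by (rule laurent_of_poly_mem_ideal2_iff[OF r])
  qed
  finally show ?thesis .
qed

section \<open>The abelianized kernel of an augmentation\<close>

text \<open>Conjugation by \<open>y\<close> restricts to an automorphism of the kernel, so it preserves the derived subgroup
  and permutes its cosets.\<close>

lemma kernel_abelianization_conjugate_closed:
  assumes G: "group G" and \<chi>: "\<chi> \<in> hom G integer_group" and y: "y \<in> carrier G"
    and C: "C \<in> carrier (kernel_abelianization G \<chi>)"
  shows "conjugate G y ` C \<in> carrier (kernel_abelianization G \<chi>)"
proof -
  interpret G: group G by fact
  interpret \<chi>: group_hom G integer_group \<chi>
    using G \<chi> by (simp add: group_hom_def group_hom_axioms_def)
  let ?k = "kernel G integer_group \<chi>"
  interpret k: normal ?k G by (rule \<chi>.normal_kernel)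
  let ?K = "G\<lparr>carrier := ?k\<rparr>"
  interpret K: group ?K by (rule G.subgroup_imp_group[OF k.subgroup_axioms])
  let ?c = "conjugate G y"
  have k_in: "g \<in> carrier G" if "g \<in> ?k" for g using that k.subset by blast
  have c_in: "?c g \<in> ?k" if "g \<in> ?k" for g
    unfolding conjugate_def by (rule k.inv_op_closed2[OF y that])
  have c_mult: "?c (g \<otimes>\<^bsub>G\<^esub> h) = ?c g \<otimes>\<^bsub>G\<^esub> ?c h" if "g \<in> ?k" "h \<in> ?k" for g h
  proof -
    have "inv\<^bsub>G\<^esub> y \<otimes>\<^bsub>G\<^esub> (y \<otimes>\<^bsub>G\<^esub> z) = z" if "z \<in> carrier G" for z
      using y that by (simp flip: G.m_assoc)
    then show ?thesis using y k_in[OF that(1)] k_in[OF that(2)] by (simp add: conjugate_def G.m_assoc)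
  qed
  interpret c: group_hom ?K ?K ?c
    using c_in c_mult by unfold_locales (auto simp: hom_def)
  have "?c ` ?k = ?k"
  proof (intro equalityI subsetI)
    fix g assume g: "g \<in> ?k"
    have "inv\<^bsub>G\<^esub> y \<otimes>\<^bsub>G\<^esub> g \<otimes>\<^bsub>G\<^esub> y \<in> ?k" by (rule k.inv_op_closed1[OF y g])
    moreover have "?c (inv\<^bsub>G\<^esub> y \<otimes>\<^bsub>G\<^esub> g \<otimes>\<^bsub>G\<^esub> y) = g"
    proof -
      have "y \<otimes>\<^bsub>G\<^esub> (inv\<^bsub>G\<^esub> y \<otimes>\<^bsub>G\<^esub> z) = z" if "z \<in> carrier G" for z
        using y that by (simp flip: G.m_assoc)
      then show ?thesis using y k_in[OF g] by (simp add: conjugate_def G.m_assoc)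
    qed
    ultimately show "g \<in> ?c ` ?k" by (metis imageI)
  qed (use c_in in auto)
  then have D: "?c ` derived ?K ?k = derived ?K ?k"
    using c.derived_img[of ?k] by simp
  have Dk: "derived ?K ?k \<subseteq> ?k" using K.derived_in_carrier[of ?k] by simp
  obtain g where g: "g \<in> ?k" "C = derived ?K ?k #>\<^bsub>?K\<^esub> g"
    using C by (auto simp: kernel_abelianization_def Let_def FactGroup_def RCOSETS_def)
  have "?c ` C = (\<Union>d\<in>derived ?K ?k. {?c (d \<otimes>\<^bsub>G\<^esub> g)})"
    by (simp add: g(2) r_coset_def image_UN)
  also have "\<dots> = (\<Union>d\<in>derived ?K ?k. {?c d \<otimes>\<^bsub>G\<^esub> ?c g})"
    using g(1) Dk c_mult by (intro SUP_cong) auto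
  also have "\<dots> = (?c ` derived ?K ?k) #>\<^bsub>?K\<^esub> ?c g"
    by (simp add: r_coset_def)
  finally have "?c ` C = derived ?K ?k #>\<^bsub>?K\<^esub> ?c g" unfolding D .
  then show ?thesis
    using c_in[OF g(1)] by (auto simp: kernel_abelianization_def Let_def FactGroup_def RCOSETS_def)
qed

lemma comm_group_kernel_abelianization:
  assumes "group G" "\<chi> \<in> hom G integer_group"
  shows "comm_group (kernel_abelianization G \<chi>)"
proof -
  interpret G: group G by fact
  interpret \<chi>: group_hom G integer_group \<chi>
    using assms by (simp add: group_hom_def group_hom_axioms_def)
  interpret K: group "G\<lparr>carrier := kernel G integer_group \<chi>\<rparr>"
    by (rule G.subgroup_imp_group[OF \<chi>.subgroup_kernel])
  show ?thesis
    using K.derived_quot_is_comm_group by (simp add: kernel_abelianization_def Let_def)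
qed

lemma augmentation_module_simps:
  "carrier (augmentation_module G \<chi> x) = carrier (kernel_abelianization G \<chi>)"
  "\<zero>\<^bsub>augmentation_module G \<chi> x\<^esub> = \<one>\<^bsub>kernel_abelianization G \<chi>\<^esub>"
  "add (augmentation_module G \<chi> x) = monoid.mult (kernel_abelianization G \<chi>)"
  by (simp_all add: augmentation_module_def Let_def)

lemma augmentation_module_abelian_group:
  assumes "group G" "\<chi> \<in> hom G integer_group"
  shows "abelian_group (augmentation_module G \<chi> x)"
proof -
  interpret A: comm_group "kernel_abelianization G \<chi>"
    by (rule comm_group_kernel_abelianization[OF assms])
  show ?thesis
    by (rule abelian_groupI) (auto simp: augmentation_module_simps A.m_ac intro: A.l_inv_ex)
qed

lemma augmentation_module_smult_closed:
  assumes G: "group G" and \<chi>: "\<chi> \<in> hom G integer_group" and x: "x \<in> carrier G"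
    and C: "C \<in> carrier (augmentation_module G \<chi> x)"
  shows "p \<odot>\<^bsub>augmentation_module G \<chi> x\<^esub> C \<in> carrier (augmentation_module G \<chi> x)"
proof -
  let ?A = "kernel_abelianization G \<chi>"
  interpret A: comm_group ?A by (rule comm_group_kernel_abelianization[OF G \<chi>])
  have "C \<in> carrier ?A" using C by (simp add: augmentation_module_simps)
  then have conj: "conjugate G (x [^]\<^bsub>G\<^esub> k) ` C \<in> carrier ?A" for k :: int
    by (intro kernel_abelianization_conjugate_closed[OF G \<chi>] group.int_pow_closed[OF G x])
  have "(\<Otimes>\<^bsub>?A\<^esub>k\<in>Poly_Mapping.keys p.
      (conjugate G (x [^]\<^bsub>G\<^esub> k) ` C) [^]\<^bsub>?A\<^esub> Poly_Mapping.lookup p k) \<in> carrier ?A"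
    using A.int_pow_closed[OF conj] by (intro A.finprod_closed) auto
  then show ?thesis by (simp add: augmentation_module_def Let_def)
qed

section \<open>The torsion number formula\<close>

theorem theorem3p4:
  fixes G :: "('g, 'x) monoid_scheme" and \<chi> :: "'g \<Rightarrow> int" and x :: 'g
    and \<Delta> :: laurent and r :: nat
  assumes "augmented_group G \<chi>"
    and "x \<in> carrier G" and "\<chi> x = 1"
    and "char_poly_0 (augmentation_module G \<chi> x) \<Delta>"
    and "module_iso (class_ring :: laurent ring) (augmentation_module G \<chi> x)
          (quotient_module regular_module (PIdl\<^bsub>class_ring\<^esub> \<Delta>))"
    and "r > 0"
  shows "real (torsion_number (augmentation_module G \<chi> x) r) =
    cmod (\<Prod>\<zeta> | \<zeta> ^ r = 1 \<and> laurent_eval \<Delta> \<zeta> \<noteq> 0.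
      laurent_eval (laurent_quotient \<Delta> (cyclotomic_part \<Delta> r)) \<zeta>)"
proof -
  let ?M = "augmentation_module G \<chi> x"
  have G: "group G" and \<chi>: "\<chi> \<in> hom G integer_group"
    using assms(1) by (auto simp: augmented_group_def epi_def)
  obtain k D where \<Delta>: "\<Delta> = lmonom (- int k) * laurent_of_poly D" by (rule laurent_eq_shifted_poly)
  let ?C = "{d. d dvd r \<and> cyclotomic d dvd D}"
  define \<Phi> where "\<Phi> = (\<Prod>d\<in>?C. cyclotomic d)"
  obtain g where g: "D = \<Phi> * g"
    and card: "real (card (cosets_in (ideal2 D (monom 1 r - 1))
        {p. \<exists>n::nat. n > 0 \<and> of_nat n * p \<in> ideal2 D (monom 1 r - 1)})) =
      cmod (\<Prod>\<zeta> | \<zeta> ^ r = 1 \<and> ceval D \<zeta> \<noteq> 0. ceval g \<zeta>)"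
    using card_torsion_cosets[OF assms(6), of D] unfolding \<Phi>_def by blast
  have eval\<Delta>: "laurent_eval \<Delta> z = z powi (- int k) * ceval D z" if "z \<noteq> 0" for z
    unfolding \<Delta> by (rule laurent_eval_shifted_poly[OF that])
  have root0: "z \<noteq> 0" if "z ^ r = 1" for z :: complex
    using that assms(6) by (auto simp: power_0_left)
  have dvd_iff: "laurent_of_poly (cyclotomic d) dvd \<Delta> \<longleftrightarrow> cyclotomic d dvd D" if "d dvd r" for d
  proof
    assume "cyclotomic d dvd D"
    then show "laurent_of_poly (cyclotomic d) dvd \<Delta>"
      unfolding \<Delta> by (intro dvd_mult laurent_of_poly_dvd)
  next
    assume "laurent_of_poly (cyclotomic d) dvd \<Delta>"
    then obtain h where h: "\<Delta> = laurent_of_poly (cyclotomic d) * h" by blast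
    have d: "d > 0" using that assms(6) by (auto intro: Nat.gr0I)
    note P = monic_with_roots_cyclotomic[OF d]
    have "ceval D \<zeta> = 0" if \<zeta>: "\<zeta> \<in> primitive_roots d" for \<zeta>
    proof -
      have nz: "\<zeta> \<noteq> 0" using \<zeta> d by (auto simp: primitive_roots_def power_0_left)
      have "ceval (cyclotomic d) \<zeta> = 0" using monic_with_rootsD(4)[OF P] \<zeta> by blast
      then have "laurent_eval \<Delta> \<zeta> = 0"
        unfolding h by (simp add: laurent_eval_mult[OF nz] laurent_eval_laurent_of_poly[OF nz])
      then show ?thesis using nz by (simp add: eval\<Delta>)
    qed
    then show "cyclotomic d dvd D" using monic_with_roots_dvd_iff[OF P] by blast
  qed
  have part: "cyclotomic_part \<Delta> r = laurent_of_poly \<Phi>"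
    unfolding cyclotomic_part_def \<Phi>_def laurent_of_poly_prod using dvd_iff by (intro prod.cong) auto
  have "\<Phi> \<noteq> 0"
  proof -
    have "cyclotomic d \<noteq> 0" if "d \<in> ?C" for d
    proof -
      have "d > 0" using that assms(6) by (auto intro: Nat.gr0I)
      from monic_with_rootsD(2)[OF monic_with_roots_cyclotomic[OF this]] show ?thesis by auto
    qed
    then show ?thesis unfolding \<Phi>_def by (cases "finite ?C") auto
  qed
  then have nz: "laurent_of_poly \<Phi> \<noteq> 0"
    using laurent_of_poly_inject[of \<Phi> 0] by (auto simp: laurent_of_poly_hom)
  have \<Delta>_eq: "\<Delta> = (lmonom (- int k) * laurent_of_poly g) * laurent_of_poly \<Phi>"
    unfolding \<Delta> by (subst g) (simp add: laurent_of_poly_hom mult_ac)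
  then have "laurent_of_poly \<Phi> dvd \<Delta>" by simp
  from laurent_quotient_mult[OF nz this] \<Delta>_eq nz
  have quot: "laurent_quotient \<Delta> (cyclotomic_part \<Delta> r) = lmonom (- int k) * laurent_of_poly g"
    unfolding part by (metis mult_right_cancel)
  have set_eq: "{\<zeta>. \<zeta> ^ r = 1 \<and> laurent_eval \<Delta> \<zeta> \<noteq> 0} = {\<zeta>. \<zeta> ^ r = 1 \<and> ceval D \<zeta> \<noteq> 0}"
    using root0 by (auto simp: eval\<Delta>)
  have "torsion_number ?M r = card (cosets_in (ideal2 D (monom 1 r - 1))
    {p. \<exists>n::nat. n > 0 \<and> of_nat n * p \<in> ideal2 D (monom 1 r - 1)})"
    using augmentation_module_abelian_group[OF G \<chi>] augmentation_module_smult_closed[OF G \<chi> assms(2)]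
      assms(5) \<Delta> assms(6) by (rule torsion_number_cyclic_module)
  then have "real (torsion_number ?M r) = (\<Prod>\<zeta> | \<zeta> ^ r = 1 \<and> ceval D \<zeta> \<noteq> 0. cmod (ceval g \<zeta>))"
    using card by (simp add: prod_norm)
  \<comment> \<open>The unit by which \<open>\<Delta>\<close> differs from \<open>D\<close> is a power of \<open>t\<close>, of modulus \<open>1\<close> at roots of unity.\<close>
  also have "\<dots> = (\<Prod>\<zeta> | \<zeta> ^ r = 1 \<and> ceval D \<zeta> \<noteq> 0.
      cmod (laurent_eval (lmonom (- int k) * laurent_of_poly g) \<zeta>))"
  proof (intro prod.cong refl)
    fix \<zeta> assume "\<zeta> \<in> {\<zeta>. \<zeta> ^ r = 1 \<and> ceval D \<zeta> \<noteq> 0}"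
    then have \<zeta>: "\<zeta> ^ r = 1" by simp
    then have "cmod \<zeta> ^ r = 1" by (metis norm_one norm_power)
    then have "cmod \<zeta> = 1" using assms(6) power_eq_1_iff[of "cmod \<zeta>" r] by simp
    then show "cmod (ceval g \<zeta>) = cmod (laurent_eval (lmonom (- int k) * laurent_of_poly g) \<zeta>)"
      by (simp add: laurent_eval_shifted_poly[OF root0[OF \<zeta>]] norm_mult norm_power_int)
  qed
  also have "\<dots> = cmod (\<Prod>\<zeta> | \<zeta> ^ r = 1 \<and> laurent_eval \<Delta> \<zeta> \<noteq> 0.
      laurent_eval (laurent_quotient \<Delta> (cyclotomic_part \<Delta> r)) \<zeta>)"
    unfolding set_eq quot by (simp add: prod_norm)
  finally show ?thesis .
qed

end
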